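(* Let $\Omega\subseteq\mathbb{H}^2$ be a relatively compact domain with differentiable boundary, and let $f:\Omega\to\mathbb{R}$ be a $C^2$ function which satisfies in $\Omega$ the minimal surfaces equation $$(1+y^2f_y^2)\,f_{xx}-y\,(f_x^2+f_y^2)\,f_y-2y^2\,f_x\,f_y\,f_{xy}+(1+y^2f_x^2)\,f_{yy}=0$$ and which extends continuously to $\overline{\Omega}$. Let $\mathcal{M}=\{(x,y,f(x,y)) : (x,y)\in\Omega\}\subset\mathbb{H}^2\times\mathbb{R}$ be the surface defined by $f$. Then for any other surface $\widetilde{\mathcal{M}}=\{(x,y,\widetilde f(x,y)) : (x,y)\in\Omega\}$ defined by a $C^2$ function $\widetilde f:\Omega\to\mathbb{R}$ that extends continuously to $\overline{\Omega}$ and has the same values as $f$ on $\partial\Omega$, the area of $\mathcal{M}$ is less than or equal to the area of $\widetilde{\mathcal{M}}$. Moreover, equality holds if and only if $f$ and $\widetilde f$ coincide on $\Omega$.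
   Context: $\mathbb{H}^2$ is the upper half-plane $\{(x,y)\in\mathbb{R}^2 : y>0\}$ with the hyperbolic metric $(dx^2+dy^2)/y^2$. The product $\mathbb{H}^2\times\mathbb{R}$ carries the metric $g=\frac{dx^2+dy^2}{y^2}+dz^2$. Subscripts denote partial derivatives. Areas of surfaces are taken with respect to the metric induced by $g$; the area of the graph of a function $u$ over $\Omega$ is $\int_\Omega \frac{1}{y^2}\sqrt{1+y^2(u_x^2+u_y^2)}\,dx\,dy$ (possibly $+\infty$). *)

theory Defs
  imports "HOL-Analysis.Analysis"
begin

definition half_plane :: "(real \<times> real) set" where
  "half_plane = {(x, y). y > 0}"

definition metric_H2R ::
    "real \<times> real \<times> real \<Rightarrow> real \<times> real \<times> real \<Rightarrow> real \<times> real \<times> real \<Rightarrow> real" where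
  "metric_H2R = (\<lambda>(x, y, z) (v1, v2, v3) (w1, w2, w3). (v1 * w1 + v2 * w2) / y\<^sup>2 + v3 * w3)"

definition Dx :: "(real \<times> real \<Rightarrow> 'a::real_normed_vector) \<Rightarrow> real \<times> real \<Rightarrow> 'a" where
  "Dx f = (\<lambda>(x, y). vector_derivative (\<lambda>t. f (t, y)) (at x))"

definition Dy :: "(real \<times> real \<Rightarrow> 'a::real_normed_vector) \<Rightarrow> real \<times> real \<Rightarrow> 'a" where
  "Dy f = (\<lambda>(x, y). vector_derivative (\<lambda>t. f (x, t)) (at y))"

definition C1_on :: "(real \<times> real) set \<Rightarrow> (real \<times> real \<Rightarrow> real) \<Rightarrow> bool" where
  "C1_on S f \<longleftrightarrow>
     (\<forall>(x, y)\<in>S. (\<lambda>t. f (t, y)) differentiable (at x) \<and> (\<lambda>t. f (x, t)) differentiable (at y)) \<and>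
     continuous_on S (Dx f) \<and> continuous_on S (Dy f)"

definition C2_on :: "(real \<times> real) set \<Rightarrow> (real \<times> real \<Rightarrow> real) \<Rightarrow> bool" where
  "C2_on S f \<longleftrightarrow> C1_on S f \<and> C1_on S (Dx f) \<and> C1_on S (Dy f)"

text \<open>
  The boundary is a regular curve of class \<open>C\<^sup>1\<close>, with the domain locally on one side of it:
  near each boundary point the domain is a sublevel set of a \<open>C\<^sup>1\<close> function without critical
  points.  (It follows that the boundary is locally the zero set of that function.)
\<close>

definition C1_boundary :: "(real \<times> real) set \<Rightarrow> bool" where
  "C1_boundary \<Omega> \<longleftrightarrow>
     (\<forall>p\<in>frontier \<Omega>. \<exists>U \<rho>. open U \<and> p \<in> U \<and> C1_on U \<rho> \<and>
        (\<forall>q\<in>U. (Dx \<rho> q, Dy \<rho> q) \<noteq> (0, 0)) \<and> \<Omega> \<inter> U = {q \<in> U. \<rho> q < 0})"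

definition continuous_extension ::
    "(real \<times> real) set \<Rightarrow> (real \<times> real \<Rightarrow> real) \<Rightarrow> (real \<times> real \<Rightarrow> real) \<Rightarrow> bool" where
  "continuous_extension \<Omega> f F \<longleftrightarrow> continuous_on (closure \<Omega>) F \<and> (\<forall>p\<in>\<Omega>. F p = f p)"

definition minimal_surface_equation ::
    "(real \<times> real) set \<Rightarrow> (real \<times> real \<Rightarrow> real) \<Rightarrow> bool" where
  "minimal_surface_equation \<Omega> f \<longleftrightarrow>
     (\<forall>(x, y)\<in>\<Omega>.
        let fx = Dx f (x, y); fy = Dy f (x, y);
            fxx = Dx (Dx f) (x, y); fxy = Dy (Dx f) (x, y); fyy = Dy (Dy f) (x, y)
        in (1 + y\<^sup>2 * fy\<^sup>2) * fxx - y * (fx\<^sup>2 + fy\<^sup>2) * fy - 2 * y\<^sup>2 * fx * fy * fxy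
             + (1 + y\<^sup>2 * fx\<^sup>2) * fyy = 0)"

definition graph_map :: "(real \<times> real \<Rightarrow> real) \<Rightarrow> real \<times> real \<Rightarrow> real \<times> real \<times> real" where
  "graph_map f = (\<lambda>(x, y). (x, y, f (x, y)))"

text \<open>
  The area of the surface parametrized by \<open>X\<close> over \<open>\<Omega>\<close> is the integral of the square root of
  the Gram determinant of the metric pulled back along \<open>X\<close>.  It may be infinite.
\<close>

definition area_H2R :: "(real \<times> real) set \<Rightarrow> (real \<times> real \<Rightarrow> real \<times> real \<times> real) \<Rightarrow> ennreal" where
  "area_H2R \<Omega> X =
     (\<integral>\<^sup>+p\<in>\<Omega>. ennreal (sqrt
        (metric_H2R (X p) (Dx X p) (Dx X p) * metric_H2R (X p) (Dy X p) (Dy X p)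
          - (metric_H2R (X p) (Dx X p) (Dy X p))\<^sup>2)) \<partial>lborel)"

lemma area_graph:
  assumes "\<Omega> \<subseteq> half_plane" and "C1_on \<Omega> f"
  shows "area_H2R \<Omega> (graph_map f) =
    (\<integral>\<^sup>+(x, y)\<in>\<Omega>. ennreal (1 / y\<^sup>2 * sqrt (1 + y\<^sup>2 * ((Dx f (x, y))\<^sup>2 + (Dy f (x, y))\<^sup>2))) \<partial>lborel)"
proof -
  have "sqrt (metric_H2R (graph_map f p) (Dx (graph_map f) p) (Dx (graph_map f) p)
          * metric_H2R (graph_map f p) (Dy (graph_map f) p) (Dy (graph_map f) p)
          - (metric_H2R (graph_map f p) (Dx (graph_map f) p) (Dy (graph_map f) p))\<^sup>2)
      = (case p of (x, y) \<Rightarrow> 1 / y\<^sup>2 * sqrt (1 + y\<^sup>2 * ((Dx f (x, y))\<^sup>2 + (Dy f (x, y))\<^sup>2)))"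
    if "p \<in> \<Omega>" for p
  proof -
    obtain x y where p: "p = (x, y)" by (cases p)
    have y: "y > 0" using assms(1) that p by (auto simp: half_plane_def)
    have "(\<lambda>t. f (t, y)) differentiable (at x)" "(\<lambda>t. f (x, t)) differentiable (at y)"
      using assms(2) that p by (auto simp: C1_on_def)
    then have "((\<lambda>t. f (t, y)) has_vector_derivative Dx f p) (at x)"
        "((\<lambda>t. f (x, t)) has_vector_derivative Dy f p) (at y)"
      by (simp_all add: Dx_def Dy_def p vector_derivative_works)
    then have "((\<lambda>t. (t, y, f (t, y))) has_vector_derivative (1, 0, Dx f p)) (at x)"
        "((\<lambda>t. (x, t, f (x, t))) has_vector_derivative (0, 1, Dy f p)) (at y)"
      by (auto intro!: has_vector_derivative_Pair has_vector_derivative_const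
          has_vector_derivative_id[unfolded id_def])
    then have D: "Dx (graph_map f) p = (1, 0, Dx f p)" "Dy (graph_map f) p = (0, 1, Dy f p)"
      by (simp_all add: Dx_def Dy_def graph_map_def p vector_derivative_at)
    have "(1 / y\<^sup>2 + a\<^sup>2) * (1 / y\<^sup>2 + b\<^sup>2) - (a * b)\<^sup>2
        = (1 / y\<^sup>2)\<^sup>2 * (1 + y\<^sup>2 * (a\<^sup>2 + b\<^sup>2))" for a b :: real
      using y by (simp add: field_simps power2_eq_square)
    then show ?thesis
      unfolding D using y
      by (simp add: p metric_H2R_def graph_map_def power2_eq_square[symmetric] real_sqrt_mult
          real_sqrt_divide)
  qed
  then show ?thesis
    unfolding area_H2R_def
    by (intro nn_integral_cong) (auto simp: indicator_def split: prod.splits)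
qed

end

(*
  The field T = grad f / W with W = sqrt (1 + y^2 |grad f|^2) is divergence free exactly when f solves
  the minimal surface equation, and by convexity of p |-> sqrt (1 + y^2 |p|^2) / y^2 the area densities
  satisfy E(g) - E(f) >= T . grad (g - f), strictly where the gradients differ.  Testing T with
  truncations of w = g - f that vanish where |w| is small, hence have compact support, yields that
  T . grad w has integral zero; no regularity of the boundary is needed for this.

  The boundary enters only in the proof that f has finite area, without which equality of two infinite
  areas would say nothing.  Near a boundary point with defining function rho, T is tested with
  f times a bump times k(- n rho - 1), where k is a smooth step.  The only term that is not
  obviously bounded contains n k'(- n rho - 1); by the fundamental theorem of calculus, its integral
  along the lines of a direction transversal to the boundary is bounded uniformly in n.
*)
theory Submission
  imports Defs "HOL-Real_Asymp.Real_Asymp"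
begin

section \<open>Functions with continuous partial derivatives\<close>

text \<open>What replaces it is that T is bounded by 1/y however steep the graph is. Hence T . grad
  w is dominated by a multiple of the sum of the two area densities, and T . grad f controls the
  density of f up to 1/y^2. The two uses of the weak equation need different cut-offs. In the
  comparison w vanishes on the boundary, so cutting off by the size of w leaves a bounded derivative
  factor; it tends to 1 where w is non-zero, and where w = 0 the gradient of w vanishes almost
  everywhere. Dominated convergence needs T . grad w to be integrable, which finiteness of both
  areas provides. For the finiteness itself f has no boundary condition to exploit; the cut-off has
  to live in the domain, and its gradient grows like n near the boundary. There the sign of T . grad
  f permits Fatou's lemma in place of a majorant.\<close>

lemma C1_on_DERIV:
  assumes "C1_on S f" "(x, y) \<in> S"
  shows "((\<lambda>t. f (t, y)) has_real_derivative Dx f (x, y)) (at x)"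
    and "((\<lambda>t. f (x, t)) has_real_derivative Dy f (x, y)) (at y)"
  using assms
  by (auto simp: C1_on_def Dx_def Dy_def has_real_derivative_iff_has_vector_derivative
      vector_derivative_works)

lemma Dx_eqI: "((\<lambda>t. f (t, y)) has_real_derivative D) (at x) \<Longrightarrow> Dx f (x, y) = D"
  by (simp add: Dx_def has_real_derivative_iff_has_vector_derivative vector_derivative_at)

lemma Dy_eqI: "((\<lambda>t. f (x, t)) has_real_derivative D) (at y) \<Longrightarrow> Dy f (x, y) = D"
  by (simp add: Dy_def has_real_derivative_iff_has_vector_derivative vector_derivative_at)

lemma C1_onI:
  assumes "\<And>x y. (x, y) \<in> S \<Longrightarrow> ((\<lambda>t. f (t, y)) has_real_derivative u (x, y)) (at x)"
    and "\<And>x y. (x, y) \<in> S \<Longrightarrow> ((\<lambda>t. f (x, t)) has_real_derivative v (x, y)) (at y)"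
    and "continuous_on S u" "continuous_on S v"
  shows "C1_on S f"
proof -
  have "Dx f p = u p" "Dy f p = v p" if "p \<in> S" for p
    using assms(1,2) that by (cases p; auto intro: Dx_eqI Dy_eqI)+
  then have "continuous_on S (Dx f)" "continuous_on S (Dy f)"
    using assms(3,4) by (auto cong: continuous_on_cong)
  then show ?thesis
    using assms(1,2) unfolding C1_on_def real_differentiable_def by (intro conjI) blast+
qed

lemma C1_on_subset: "C1_on S f \<Longrightarrow> T \<subseteq> S \<Longrightarrow> C1_on T f"
  unfolding C1_on_def by (auto intro: continuous_on_subset)

text \<open>Upgrades partial derivatives to the total one. This provides the continuity of
  \<open>f\<close>, which \<open>C1_on\<close> does not state, and at the very end the constancy of
  a function with zero gradient.\<close>

lemma C1_on_has_derivative: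
  assumes "C1_on S f" "open S" "(x, y) \<in> S"
  shows "(f has_derivative (\<lambda>(h, k). Dx f (x, y) * h + Dy f (x, y) * k)) (at (x, y))"
proof -
  obtain A B where "open A" "open B" "(x, y) \<in> A \<times> B" "A \<times> B \<subseteq> S"
    by (rule open_prod_elim[OF assms(2,3)])
  then have AB: "open A" "open B" "x \<in> A" "y \<in> B" "A \<times> B \<subseteq> S" by simp_all
  obtain e where e: "e > 0" "ball y e \<subseteq> B"
    using AB(2,4) by (rule openE)
  \<comment> \<open>The mean value argument behind \<open>has_derivative_partialsI\<close> moves
    along the second variable and so wants that factor convex.\<close>
  define Y where "Y = ball y e"
  have Y: "open Y" "convex Y" "y \<in> Y" "A \<times> Y \<subseteq> S"
    using e AB by (auto simp: Y_def)
  have open_AY: "open (A \<times> Y)" using AB Y by (simp add: open_Times)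
  have "continuous_on (A \<times> Y) (Dy f)"
    using assms(1) Y by (auto simp: C1_on_def intro: continuous_on_subset)
  then have contDy: "isCont (Dy f) (x, y)"
    using open_AY AB(3) Y(3) by (simp add: continuous_on_eq_continuous_at)
  have "((\<lambda>(x, y). f (x, y)) has_derivative
     (\<lambda>(tx, ty). (\<lambda>h. Dx f (x, y) * h) tx
        + blinfun_apply ((\<lambda>x y. blinfun_scaleR_left (Dy f (x, y))) x y) ty)) (at (x, y) within A \<times> Y)"
  proof (rule has_derivative_partialsI)
    show "((\<lambda>x. f (x, y)) has_derivative (*) (Dx f (x, y))) (at x within A)"
      using C1_on_DERIV(1)[OF assms(1,3)] by (simp add: has_field_derivative_def has_derivative_at_withinI)
    fix x' y' assume "x' \<in> A" "y' \<in> Y"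
    then have "(x', y') \<in> S" using Y by auto
    then show "((\<lambda>y. f (x', y)) has_derivative blinfun_apply (blinfun_scaleR_left (Dy f (x', y'))))
           (at y' within Y)"
      using C1_on_DERIV(2)[OF assms(1), of x' y']
      by (simp add: has_field_derivative_def has_derivative_at_withinI mult.commute[of _ "Dy f (x', y')"])
  next
    have "isCont (\<lambda>p. blinfun_scaleR_left (Dy f p)::real \<Rightarrow>\<^sub>L real) (x, y)"
      using contDy by (auto intro!: continuous_intros)
    then show "continuous (at (x, y) within A \<times> Y) (\<lambda>(x, y). blinfun_scaleR_left (Dy f (x, y))::real \<Rightarrow>\<^sub>L real)"
      by (simp add: case_prod_beta' continuous_at_imp_continuous_at_within)
  qed (use Y in auto)
  then have "(f has_derivative (\<lambda>(h, k). Dx f (x, y) * h + Dy f (x, y) * k)) (at (x, y) within A \<times> Y)"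
    by (simp add: case_prod_beta' mult.commute)
  then show ?thesis
    using at_within_open[OF _ open_AY, of "(x, y)"] AB(3) Y(3) by simp
qed

lemma C1_on_imp_continuous_on:
  assumes "C1_on S f" "open S"
  shows "continuous_on S f"
proof -
  have "isCont f p" if "p \<in> S" for p
  proof -
    have "(fst p, snd p) \<in> S" using that by simp
    from has_derivative_continuous[OF C1_on_has_derivative[OF assms this]] show ?thesis by simp
  qed
  then show ?thesis by (simp add: continuous_at_imp_continuous_on)
qed

lemma
  assumes f: "C1_on S f" and g: "C1_on S g" and "open S"
  shows C1_on_mult: "C1_on S (\<lambda>p. f p * g p)"
    and Dx_mult: "p \<in> S \<Longrightarrow> Dx (\<lambda>p. f p * g p) p = f p * Dx g p + Dx f p * g p"
    and Dy_mult: "p \<in> S \<Longrightarrow> Dy (\<lambda>p. f p * g p) p = f p * Dy g p + Dy f p * g p"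
    and C1_on_diff: "C1_on S (\<lambda>p. f p - g p)"
    and Dx_diff: "p \<in> S \<Longrightarrow> Dx (\<lambda>p. f p - g p) p = Dx f p - Dx g p"
    and Dy_diff: "p \<in> S \<Longrightarrow> Dy (\<lambda>p. f p - g p) p = Dy f p - Dy g p"
proof -
  note D = C1_on_DERIV[OF f] C1_on_DERIV[OF g]
  have cont: "continuous_on S f" "continuous_on S g" "continuous_on S (Dx f)" "continuous_on S (Dy f)"
     "continuous_on S (Dx g)" "continuous_on S (Dy g)"
    using f g C1_on_imp_continuous_on[OF _ \<open>open S\<close>] unfolding C1_on_def by blast+
  have m: "((\<lambda>t. f (t, y) * g (t, y)) has_real_derivative f (x, y) * Dx g (x, y) + Dx f (x, y) * g (x, y)) (at x)"
    "((\<lambda>t. f (x, t) * g (x, t)) has_real_derivative f (x, y) * Dy g (x, y) + Dy f (x, y) * g (x, y)) (at y)"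
    "((\<lambda>t. f (t, y) - g (t, y)) has_real_derivative Dx f (x, y) - Dx g (x, y)) (at x)"
    "((\<lambda>t. f (x, t) - g (x, t)) has_real_derivative Dy f (x, y) - Dy g (x, y)) (at y)"
    if "(x, y) \<in> S" for x y
    using that by (auto intro!: derivative_eq_intros D)
  show "C1_on S (\<lambda>p. f p * g p)"
    by (rule C1_onI[where u="\<lambda>p. f p * Dx g p + Dx f p * g p" and v="\<lambda>p. f p * Dy g p + Dy f p * g p"])
       (use m cont in \<open>auto intro!: continuous_intros\<close>)
  show "C1_on S (\<lambda>p. f p - g p)"
    by (rule C1_onI[where u="\<lambda>p. Dx f p - Dx g p" and v="\<lambda>p. Dy f p - Dy g p"])
       (use m cont in \<open>auto intro!: continuous_intros\<close>)
  assume "p \<in> S"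
  then show "Dx (\<lambda>p. f p * g p) p = f p * Dx g p + Dx f p * g p"
     "Dy (\<lambda>p. f p * g p) p = f p * Dy g p + Dy f p * g p"
     "Dx (\<lambda>p. f p - g p) p = Dx f p - Dx g p" "Dy (\<lambda>p. f p - g p) p = Dy f p - Dy g p"
    using m by (cases p; auto intro!: Dx_eqI Dy_eqI)+
qed

lemma
  assumes f: "C1_on S f" and "open S"
    and \<phi>: "\<And>t. (\<phi> has_real_derivative \<phi>' t) (at t)" and cont': "continuous_on UNIV \<phi>'"
  shows C1_on_comp: "C1_on S (\<lambda>p. \<phi> (f p))"
    and Dx_comp: "p \<in> S \<Longrightarrow> Dx (\<lambda>p. \<phi> (f p)) p = \<phi>' (f p) * Dx f p"
    and Dy_comp: "p \<in> S \<Longrightarrow> Dy (\<lambda>p. \<phi> (f p)) p = \<phi>' (f p) * Dy f p"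
proof -
  have m: "((\<lambda>t. \<phi> (f (t, y))) has_real_derivative \<phi>' (f (x, y)) * Dx f (x, y)) (at x)"
    "((\<lambda>t. \<phi> (f (x, t))) has_real_derivative \<phi>' (f (x, y)) * Dy f (x, y)) (at y)"
    if "(x, y) \<in> S" for x y
    using DERIV_chain2[OF \<phi> C1_on_DERIV(1)[OF f that]] DERIV_chain2[OF \<phi> C1_on_DERIV(2)[OF f that]]
    by auto
  have cont: "continuous_on S f" "continuous_on S (Dx f)" "continuous_on S (Dy f)"
    using f C1_on_imp_continuous_on[OF _ \<open>open S\<close>] unfolding C1_on_def by blast+
  have "continuous_on S (\<lambda>p. \<phi>' (f p))"
    using continuous_on_compose2[OF cont' cont(1)] by auto
  then show "C1_on S (\<lambda>p. \<phi> (f p))"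
    by (intro C1_onI[where u="\<lambda>p. \<phi>' (f p) * Dx f p" and v="\<lambda>p. \<phi>' (f p) * Dy f p"])
       (use m cont in \<open>auto intro!: continuous_intros\<close>)
  assume "p \<in> S"
  then show "Dx (\<lambda>p. \<phi> (f p)) p = \<phi>' (f p) * Dx f p" "Dy (\<lambda>p. \<phi> (f p)) p = \<phi>' (f p) * Dy f p"
    using m by (cases p; auto intro!: Dx_eqI Dy_eqI)+
qed

text \<open>The mean value theorem in the first variable, applied to
  \<open>f (r, y+h) - f (r, y)\<close>, followed by one in the second. The left side is symmetric in
  the two coordinates, so the lemma serves either order of differentiation.\<close>

lemma mixed_difference_MVT:
  fixes f u v :: "real \<times> real \<Rightarrow> real"
  assumes "h > 0"
    and u: "\<And>s t. s \<in> {x..x+h} \<Longrightarrow> t \<in> {y..y+h} \<Longrightarrow> ((\<lambda>r. f (r, t)) has_real_derivative u (s, t)) (at s)"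
    and v: "\<And>s t. s \<in> {x..x+h} \<Longrightarrow> t \<in> {y..y+h} \<Longrightarrow> ((\<lambda>r. u (s, r)) has_real_derivative v (s, t)) (at t)"
  shows "\<exists>s\<in>{x..x+h}. \<exists>t\<in>{y..y+h}.
    f (x+h, y+h) - f (x, y+h) - f (x+h, y) + f (x, y) = h * h * v (s, t)"
proof -
  have "\<exists>s. x < s \<and> s < x + h \<and> (f (x+h, y+h) - f (x+h, y)) - (f (x, y+h) - f (x, y))
      = (x + h - x) * (u (s, y+h) - u (s, y))"
    by (rule MVT2) (use \<open>h > 0\<close> in \<open>auto intro!: DERIV_diff u\<close>)
  then obtain s where s: "x < s" "s < x + h"
    "(f (x+h, y+h) - f (x+h, y)) - (f (x, y+h) - f (x, y)) = h * (u (s, y+h) - u (s, y))" by auto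
  have "\<exists>t. y < t \<and> t < y + h \<and> u (s, y+h) - u (s, y) = (y + h - y) * v (s, t)"
    by (rule MVT2) (use \<open>h > 0\<close> s in \<open>auto intro!: v\<close>)
  then obtain t where t: "y < t" "t < y + h" "u (s, y+h) - u (s, y) = h * v (s, t)" by auto
  show ?thesis
    using s t by (intro bexI[of _ s] bexI[of _ t]) (auto simp: algebra_simps)
qed

text \<open>The minimal surface equation contains \<open>Dy (Dx f)\<close>, the divergence of the
  flux also \<open>Dx (Dy f)\<close>. Both are read off from the same second difference over a small
  square, at possibly different points of it; if their values at \<open>p\<close> differed,
  continuity would separate them on the whole square.\<close>

lemma C2_on_mixed_partials_commute:
  assumes f: "C2_on S f" and "open S" "p \<in> S"
  shows "Dy (Dx f) p = Dx (Dy f) p"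
proof (rule ccontr)
  assume ne: "Dy (Dx f) p \<noteq> Dx (Dy f) p"
  obtain x y where p: "p = (x, y)" by (cases p)
  define \<epsilon> where "\<epsilon> = \<bar>Dy (Dx f) p - Dx (Dy f) p\<bar> / 2"
  have \<epsilon>: "\<epsilon> > 0" using ne by (simp add: \<epsilon>_def)
  have C: "C1_on S f" "C1_on S (Dx f)" "C1_on S (Dy f)" using f by (auto simp: C2_on_def)
  have "isCont (Dy (Dx f)) p" "isCont (Dx (Dy f)) p"
    using C(2,3) assms by (auto simp: C1_on_def continuous_on_eq_continuous_at)
  then obtain d1 d2 where d: "d1 > 0" "d2 > 0"
      "\<And>q. dist q p < d1 \<Longrightarrow> dist (Dy (Dx f) q) (Dy (Dx f) p) < \<epsilon>"
      "\<And>q. dist q p < d2 \<Longrightarrow> dist (Dx (Dy f) q) (Dx (Dy f) p) < \<epsilon>"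
    using \<epsilon> unfolding continuous_at_eps_delta by metis
  obtain d0 where d0: "d0 > 0" "ball p d0 \<subseteq> S" using assms openE by blast
  \<comment> \<open>Points of the square with side \<open>h\<close> lie within \<open>2 * h\<close>
    of its corner; the divisor 3 makes that strictly smaller than all three radii.\<close>
  define h where "h = min d0 (min d1 d2) / 3"
  have h: "h > 0" using d d0 by (simp add: h_def)
  have near: "dist (s, t) p < d0 \<and> dist (s, t) p < d1 \<and> dist (s, t) p < d2"
    if "s \<in> {x..x+h}" "t \<in> {y..y+h}" for s t
  proof -
    have "dist (s, t) p \<le> dist s x + dist t y"
      unfolding p dist_Pair_Pair by (rule sqrt_sum_squares_le_sum) auto
    also have "\<dots> \<le> 2 * h" using that by (auto simp: dist_real_def)
    also have "\<dots> < 3 * h" using h by simp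
    finally show ?thesis unfolding h_def by simp
  qed
  have inS: "(s, t) \<in> S" if "s \<in> {x..x+h}" "t \<in> {y..y+h}" for s t
    using near[OF that] d0 by (auto simp: dist_commute)
  obtain s t where st: "s \<in> {x..x+h}" "t \<in> {y..y+h}"
     "f (x+h, y+h) - f (x, y+h) - f (x+h, y) + f (x, y) = h * h * Dy (Dx f) (s, t)"
    using mixed_difference_MVT[of h x y f "Dx f" "Dy (Dx f)"] h inS C1_on_DERIV[OF C(1)] C1_on_DERIV[OF C(2)] by auto
  obtain t' s' where st': "t' \<in> {y..y+h}" "s' \<in> {x..x+h}"
     "f (x+h, y+h) - f (x+h, y) - f (x, y+h) + f (x, y) = h * h * Dx (Dy f) (s', t')"
    using mixed_difference_MVT[of h y x "\<lambda>(a, b). f (b, a)" "\<lambda>(a, b). Dy f (b, a)" "\<lambda>(a, b). Dx (Dy f) (b, a)"]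
      h inS C1_on_DERIV[OF C(1)] C1_on_DERIV[OF C(3)] by auto
  have "h * h * Dy (Dx f) (s, t) = h * h * Dx (Dy f) (s', t')" using st(3) st'(3) by linarith
  then have eq: "Dy (Dx f) (s, t) = Dx (Dy f) (s', t')" using h by simp
  have "dist (Dy (Dx f) (s, t)) (Dy (Dx f) p) < \<epsilon>" "dist (Dx (Dy f) (s', t')) (Dx (Dy f) p) < \<epsilon>"
    using d near st(1,2) st'(1,2) by auto
  then show False unfolding eq \<epsilon>_def dist_real_def by argo
qed

section \<open>Divergence free fields and compactly supported functions\<close>

text \<open>On every horizontal line the integral is a difference of two values of \<open>u\<close>
  outside \<open>K\<close>; Fubini does the rest. Both functions live on the whole plane, so no
  domain has to be sliced.\<close>

lemma integral_Dx_eq_0: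
  fixes u v :: "real \<times> real \<Rightarrow> real"
  assumes K: "compact K"
    and D: "\<And>x y. ((\<lambda>t. u (t, y)) has_real_derivative v (x, y)) (at x)"
    and v: "continuous_on UNIV v" and 0: "\<And>p. p \<notin> K \<Longrightarrow> u p = 0" "\<And>p. p \<notin> K \<Longrightarrow> v p = 0"
  shows "integrable lborel v" and "(\<integral>p. v p \<partial>lborel) = 0"
proof -
  have "integrable lborel (\<lambda>p. indicator K p *\<^sub>R v p)"
    by (rule borel_integrable_compact[OF K continuous_on_subset[OF v]]) auto
  moreover have "(\<lambda>p. indicator K p *\<^sub>R v p) = v"
    using 0(2) by (fastforce simp: indicator_def fun_eq_iff)
  ultimately show int: "integrable lborel v" by simp
  obtain a where a: "a > 0" "\<And>p. p \<in> K \<Longrightarrow> norm p \<le> a"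
    using compact_imp_bounded[OF K] bounded_pos by blast
  have out: "(x, y) \<notin> K" if "\<bar>x\<bar> > a" for x y
    using a(2)[of "(x, y)"] norm_fst_le[of x y] that by auto
  \<comment> \<open>The interval is longer than [-a, a] because points of \<open>K\<close> may have
    norm exactly \<open>a\<close>; at distance \<open>a + 1\<close> the functions are certainly
    zero.\<close>
  have v_out: "v (x, y) = 0" if "\<not> (-(a+1) \<le> x \<and> x \<le> a+1)" for x y
    using that by (intro 0(2) out) linarith
  have inner: "(\<integral>x. v (x, y) \<partial>lborel) = 0" for y
  proof -
    have "(\<integral>x. v (x, y) \<partial>lborel) = (\<integral>x. v (x, y) * indicator {-(a+1)..a+1} x \<partial>lborel)"
      by (rule Bochner_Integration.integral_cong) (use v_out in \<open>force simp: indicator_def\<close>)+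
    also have "\<dots> = u (a+1, y) - u (-(a+1), y)"
    proof (rule integral_FTC_Icc_real)
      show "isCont (\<lambda>x. v (x, y)) x" for x
        using continuous_on_compose2[OF v, of UNIV "\<lambda>x. (x, y)"]
        by (auto simp: continuous_on_eq_continuous_at intro!: continuous_intros)
    qed (use a D in auto)
    also have "\<dots> = 0" using 0(1) out a(1) by auto
    finally show ?thesis .
  qed
  have "(\<integral>y. (\<integral>x. v (x, y) \<partial>lborel) \<partial>lborel) = integral\<^sup>L (lborel \<Otimes>\<^sub>M lborel) (\<lambda>(x, y). v (x, y))"
    by (rule lborel_pair.integral_snd) (use int in \<open>simp add: lborel_prod\<close>)
  then show "(\<integral>p. v p \<partial>lborel) = 0"
    by (simp add: inner lborel_prod)
qed

text \<open>The same along vertical lines, with the other order of integration.\<close>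

lemma integral_Dy_eq_0:
  fixes u v :: "real \<times> real \<Rightarrow> real"
  assumes K: "compact K"
    and D: "\<And>x y. ((\<lambda>t. u (x, t)) has_real_derivative v (x, y)) (at y)"
    and v: "continuous_on UNIV v" and 0: "\<And>p. p \<notin> K \<Longrightarrow> u p = 0" "\<And>p. p \<notin> K \<Longrightarrow> v p = 0"
  shows "integrable lborel v" and "(\<integral>p. v p \<partial>lborel) = 0"
proof -
  have "integrable lborel (\<lambda>p. indicator K p *\<^sub>R v p)"
    by (rule borel_integrable_compact[OF K continuous_on_subset[OF v]]) auto
  moreover have "(\<lambda>p. indicator K p *\<^sub>R v p) = v"
    using 0(2) by (fastforce simp: indicator_def fun_eq_iff)
  ultimately show int: "integrable lborel v" by simp
  obtain a where a: "a > 0" "\<And>p. p \<in> K \<Longrightarrow> norm p \<le> a"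
    using compact_imp_bounded[OF K] bounded_pos by blast
  have out: "(x, y) \<notin> K" if "\<bar>y\<bar> > a" for x y
    using a(2)[of "(x, y)"] norm_snd_le[of y x] that by auto
  have v_out: "v (x, y) = 0" if "\<not> (-(a+1) \<le> y \<and> y \<le> a+1)" for x y
    using that by (intro 0(2) out) linarith
  have inner: "(\<integral>y. v (x, y) \<partial>lborel) = 0" for x
  proof -
    have "(\<integral>y. v (x, y) \<partial>lborel) = (\<integral>y. v (x, y) * indicator {-(a+1)..a+1} y \<partial>lborel)"
      by (rule Bochner_Integration.integral_cong) (use v_out in \<open>force simp: indicator_def\<close>)+
    also have "\<dots> = u (x, a+1) - u (x, -(a+1))"
    proof (rule integral_FTC_Icc_real)
      show "isCont (\<lambda>y. v (x, y)) y" for y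
        using continuous_on_compose2[OF v, of UNIV "\<lambda>y. (x, y)"]
        by (auto simp: continuous_on_eq_continuous_at intro!: continuous_intros)
    qed (use a D in auto)
    also have "\<dots> = 0" using 0(1) out a(1) by auto
    finally show ?thesis .
  qed
  have "(\<integral>x. (\<integral>y. v (x, y) \<partial>lborel) \<partial>lborel) = integral\<^sup>L (lborel \<Otimes>\<^sub>M lborel) (\<lambda>(x, y). v (x, y))"
    by (rule lborel_pair.integral_fst) (use int in \<open>simp add: lborel_prod\<close>)
  then show "(\<integral>p. v p \<partial>lborel) = 0"
    by (simp add: inner lborel_prod)
qed

text \<open>Extension by zero leads from \<open>S\<close> to the plane: \<open>S\<close> and the
  complement of \<open>K\<close> are open and cover the plane, and the extension is \<open>u\<close>
  on the one and 0 on the other.\<close>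

lemma C1_on_integral_partials_eq_0:
  assumes u: "C1_on S u" and "open S" and K: "compact K" "K \<subseteq> S" and 0: "\<And>p. p \<in> S - K \<Longrightarrow> u p = 0"
  shows "integrable lborel (\<lambda>p. indicator S p * Dx u p)" "(\<integral>p. indicator S p * Dx u p \<partial>lborel) = 0"
    and "integrable lborel (\<lambda>p. indicator S p * Dy u p)" "(\<integral>p. indicator S p * Dy u p \<partial>lborel) = 0"
proof -
  have openK: "open (-K)" using K by (simp add: compact_imp_closed open_Compl)
  have UN: "UNIV = S \<union> (-K)" using K by auto
  define w where "w = (\<lambda>p. if p \<in> S then u p else 0)"
  have w0: "w p = 0" if "p \<notin> K" for p using 0 that by (auto simp: w_def)
  have near0: "\<forall>\<^sub>F t in nhds x. w (t, y) = 0" "\<forall>\<^sub>F t in nhds y. w (x, t) = 0"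
    if "(x, y) \<notin> K" for x y
  proof -
    have "open ((\<lambda>t. (t, y)) -` (-K))" "open ((\<lambda>t. (x, t)) -` (-K))"
      by (intro open_vimage openK continuous_intros)+
    then show "\<forall>\<^sub>F t in nhds x. w (t, y) = 0" "\<forall>\<^sub>F t in nhds y. w (x, t) = 0"
      using that w0 unfolding eventually_nhds by (metis ComplD ComplI vimageE vimageI2)+
  qed
  have nearS: "\<forall>\<^sub>F t in nhds x. w (t, y) = u (t, y)" "\<forall>\<^sub>F t in nhds y. w (x, t) = u (x, t)"
    if "(x, y) \<in> S" for x y
  proof -
    have "open ((\<lambda>t. (t, y)) -` S)" "open ((\<lambda>t. (x, t)) -` S)"
      by (intro open_vimage \<open>open S\<close> continuous_intros)+
    then show "\<forall>\<^sub>F t in nhds x. w (t, y) = u (t, y)" "\<forall>\<^sub>F t in nhds y. w (x, t) = u (x, t)"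
      using that unfolding eventually_nhds w_def by (metis vimageE vimageI2)+
  qed
  have der0: "((\<lambda>t. w (t, y)) has_real_derivative 0) (at x)" "((\<lambda>t. w (x, t)) has_real_derivative 0) (at y)"
    if "(x, y) \<notin> K" for x y
    using near0[OF that] by (auto simp: DERIV_cong_ev[OF refl _ refl])
  have derS: "((\<lambda>t. w (t, y)) has_real_derivative Dx u (x, y)) (at x)"
    "((\<lambda>t. w (x, t)) has_real_derivative Dy u (x, y)) (at y)" if "(x, y) \<in> S" for x y
    using nearS[OF that] C1_on_DERIV[OF u that] by (auto simp: DERIV_cong_ev[OF refl _ refl])
  \<comment> \<open>On \<open>S - K\<close> the extension is both \<open>u\<close> and locally zero,
    so uniqueness of derivatives makes the partials of \<open>u\<close> vanish there.\<close>
  have D0: "Dx u p = 0" "Dy u p = 0" if "p \<in> S - K" for p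
    using der0[of "fst p" "snd p"] derS[of "fst p" "snd p"] that
    by (auto dest: DERIV_unique)
  have D: "((\<lambda>t. w (t, y)) has_real_derivative indicator S (x, y) * Dx u (x, y)) (at x)"
    "((\<lambda>t. w (x, t)) has_real_derivative indicator S (x, y) * Dy u (x, y)) (at y)" for x y
    using der0[of x y] derS[of x y] K by (cases "(x, y) \<in> S"; force)+
  have v0: "indicator S p * Dx u p = 0" "indicator S p * Dy u p = 0" if "p \<notin> K" for p
    using D0[of p] that by (auto simp: indicator_def)
  have cont: "continuous_on UNIV (\<lambda>p. indicator S p * h p)"
    if h: "continuous_on S h" "\<And>p. p \<in> S - K \<Longrightarrow> h p = 0" for h :: "real \<times> real \<Rightarrow> real"
  proof -
    have "continuous_on S (\<lambda>p. indicator S p * h p)"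
      using h(1) by (rule continuous_on_eq) simp
    moreover have "continuous_on (-K) (\<lambda>p. indicator S p * h p)"
      by (rule continuous_on_eq[of _ "\<lambda>_. 0"]) (use h(2) in \<open>auto simp: indicator_def\<close>)
    ultimately show ?thesis
      unfolding UN using \<open>open S\<close> openK by (intro continuous_on_open_Un) auto
  qed
  have contD: "continuous_on UNIV (\<lambda>p. indicator S p * Dx u p)" "continuous_on UNIV (\<lambda>p. indicator S p * Dy u p)"
    using u D0 by (auto simp: C1_on_def intro!: cont)
  show "integrable lborel (\<lambda>p. indicator S p * Dx u p)" "(\<integral>p. indicator S p * Dx u p \<partial>lborel) = 0"
    by (rule integral_Dx_eq_0[OF K(1) D(1) contD(1) w0 v0(1)]; assumption)+
  show "integrable lborel (\<lambda>p. indicator S p * Dy u p)" "(\<integral>p. indicator S p * Dy u p \<partial>lborel) = 0"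
    by (rule integral_Dy_eq_0[OF K(1) D(2) contD(2) w0 v0(2)]; assumption)+
qed

text \<open>The integrand is the divergence of \<open>\<phi>\<close> times the field, because the
  term with the divergence of the field drops out. Test functions are asked to be C^1 only, so they
  can be built from \<open>f\<close>, from the difference of two graphs and from a defining function
  of the boundary.\<close>

lemma integral_divergence_free:
  assumes P: "C1_on S P" and Q: "C1_on S Q" and div: "\<And>p. p \<in> S \<Longrightarrow> Dx P p + Dy Q p = 0"
    and \<phi>: "C1_on S \<phi>" and S: "open S" and K: "compact K" "K \<subseteq> S" "\<And>p. p \<in> S - K \<Longrightarrow> \<phi> p = 0"
  shows "integrable lborel (\<lambda>p. indicator S p * (P p * Dx \<phi> p + Q p * Dy \<phi> p))"
    and "(\<integral>p. indicator S p * (P p * Dx \<phi> p + Q p * Dy \<phi> p) \<partial>lborel) = 0"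
proof -
  have 0: "P p * \<phi> p = 0" "Q p * \<phi> p = 0" if "p \<in> S - K" for p using K that by auto
  note x = C1_on_integral_partials_eq_0(1,2)[OF C1_on_mult[OF P \<phi> S] S K(1,2) 0(1)]
  note y = C1_on_integral_partials_eq_0(3,4)[OF C1_on_mult[OF Q \<phi> S] S K(1,2) 0(2)]
  have eq: "indicator S p * Dx (\<lambda>p. P p * \<phi> p) p + indicator S p * Dy (\<lambda>p. Q p * \<phi> p) p
      = indicator S p * (P p * Dx \<phi> p + Q p * Dy \<phi> p)" for p
  proof (cases "p \<in> S")
    case True
    have "P p * Dx \<phi> p + Dx P p * \<phi> p + (Q p * Dy \<phi> p + Dy Q p * \<phi> p)
        = P p * Dx \<phi> p + Q p * Dy \<phi> p + (Dx P p + Dy Q p) * \<phi> p" by algebra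
    then show ?thesis
      using True div[OF True] by (simp add: Dx_mult[OF P \<phi> S] Dy_mult[OF Q \<phi> S])
  qed simp
  show "integrable lborel (\<lambda>p. indicator S p * (P p * Dx \<phi> p + Q p * Dy \<phi> p))"
    using Bochner_Integration.integrable_add[OF x(1) y(1)] unfolding eq by simp
  show "(\<integral>p. indicator S p * (P p * Dx \<phi> p + Q p * Dy \<phi> p) \<partial>lborel) = 0"
    using Bochner_Integration.integral_add[OF x(1) y(1)] x(2) y(2) unfolding eq by simp
qed

section \<open>The flux of a minimal graph\<close>

text \<open>The overview's W: the ratio between the area element of the graph and that of the
  hyperbolic plane below it.\<close>

definition slope_factor :: "(real \<times> real \<Rightarrow> real) \<Rightarrow> real \<times> real \<Rightarrow> real" where
  "slope_factor f p = sqrt (1 + (snd p)\<^sup>2 * ((Dx f p)\<^sup>2 + (Dy f p)\<^sup>2))"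

lemma slope_factor_ge_1: "slope_factor f p \<ge> 1"
  by (simp add: slope_factor_def)

lemma slope_factor_pos: "slope_factor f p > 0"
  using slope_factor_ge_1[of f p] by linarith

lemma slope_factor_square: "(slope_factor f p)\<^sup>2 = 1 + (snd p)\<^sup>2 * ((Dx f p)\<^sup>2 + (Dy f p)\<^sup>2)"
  by (simp add: slope_factor_def)

text \<open>The hypothesis has \<open>2 * q'\<close> so that the 2 from the square root cancels. The
  denominator \<open>q t * sqrt (q t)\<close> is the same for both partials of the flux, so their
  sum has a single numerator.\<close>

lemma DERIV_divide_sqrt:
  fixes h q :: "real \<Rightarrow> real"
  assumes "(h has_real_derivative h') (at t)" "(q has_real_derivative 2 * q') (at t)" "q t > 0"
  shows "((\<lambda>t. h t / sqrt (q t)) has_real_derivative (h' * q t - h t * q') / (q t * sqrt (q t))) (at t)"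
proof -
  have s: "sqrt (q t) > 0" "q t = sqrt (q t) * sqrt (q t)" using assms(3) by auto
  have "((\<lambda>t. h t / sqrt (q t)) has_real_derivative
      (h' * sqrt (q t) - h t * (inverse (sqrt (q t)) / 2 * (2 * q'))) / (sqrt (q t) * sqrt (q t))) (at t)"
    by (rule DERIV_divide[OF assms(1) DERIV_chain2[OF DERIV_real_sqrt assms(2)]]) (use assms(3) in auto)
  moreover have "(h' * s - h t * (inverse s / 2 * (2 * q'))) / (s * s) = (h' * (s * s) - h t * q') / ((s * s) * s)"
    if "s > 0" for s using that by (simp add: field_simps)
  ultimately show ?thesis using s by metis
qed

text \<open>In the vertical derivative the summand with a bare \<open>snd p\<close> arises from
  differentiating y^2 in \<open>q\<close>; for \<open>h = Dy f\<close> it becomes the first-order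
  term of the minimal surface equation.\<close>

lemma
  fixes f h :: "real \<times> real \<Rightarrow> real"
  assumes f: "C2_on S f" and h: "C1_on S h" and S: "open S"
  defines "q \<equiv> \<lambda>p. 1 + (snd p)\<^sup>2 * ((Dx f p)\<^sup>2 + (Dy f p)\<^sup>2)"
  shows C1_on_divide_slope_factor: "C1_on S (\<lambda>p. h p / slope_factor f p)"
    and Dx_divide_slope_factor: "p \<in> S \<Longrightarrow> Dx (\<lambda>p. h p / slope_factor f p) p =
      (Dx h p * q p - h p * ((snd p)\<^sup>2 * (Dx f p * Dx (Dx f) p + Dy f p * Dx (Dy f) p))) / (q p * sqrt (q p))"
    and Dy_divide_slope_factor: "p \<in> S \<Longrightarrow> Dy (\<lambda>p. h p / slope_factor f p) p =
      (Dy h p * q p - h p * (snd p * ((Dx f p)\<^sup>2 + (Dy f p)\<^sup>2)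
         + (snd p)\<^sup>2 * (Dx f p * Dy (Dx f) p + Dy f p * Dy (Dy f) p))) / (q p * sqrt (q p))" (is "_ \<Longrightarrow> _ = ?v p")
proof -
  let ?u = "\<lambda>p. (Dx h p * q p - h p * ((snd p)\<^sup>2 * (Dx f p * Dx (Dx f) p + Dy f p * Dx (Dy f) p))) / (q p * sqrt (q p))"
  let ?v = "\<lambda>p. (Dy h p * q p - h p * (snd p * ((Dx f p)\<^sup>2 + (Dy f p)\<^sup>2)
         + (snd p)\<^sup>2 * (Dx f p * Dy (Dx f) p + Dy f p * Dy (Dy f) p))) / (q p * sqrt (q p))"
  have C: "C1_on S (Dx f)" "C1_on S (Dy f)" using f by (auto simp: C2_on_def)
  have q: "q p > 0" for p
    by (simp add: q_def add_pos_nonneg)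
  have cont: "continuous_on S (Dx f)" "continuous_on S (Dy f)" "continuous_on S h"
      "continuous_on S (Dx h)" "continuous_on S (Dy h)"
      "continuous_on S (Dx (Dx f))" "continuous_on S (Dy (Dx f))" "continuous_on S (Dx (Dy f))"
      "continuous_on S (Dy (Dy f))"
    using C h C1_on_imp_continuous_on[OF _ S] unfolding C1_on_def by blast+
  have contq: "continuous_on S q" unfolding q_def by (intro continuous_intros cont)
  have dq: "((\<lambda>t. q (t, y)) has_real_derivative
        2 * (y\<^sup>2 * (Dx f (x, y) * Dx (Dx f) (x, y) + Dy f (x, y) * Dx (Dy f) (x, y)))) (at x)"
     "((\<lambda>t. q (x, t)) has_real_derivative
        2 * (y * ((Dx f (x, y))\<^sup>2 + (Dy f (x, y))\<^sup>2)
         + y\<^sup>2 * (Dx f (x, y) * Dy (Dx f) (x, y) + Dy f (x, y) * Dy (Dy f) (x, y)))) (at y)"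
    if "(x, y) \<in> S" for x y
    unfolding q_def
    by (auto intro!: derivative_eq_intros C1_on_DERIV[OF C(1) that] C1_on_DERIV[OF C(2) that] simp: algebra_simps)
  have D: "((\<lambda>t. h (t, y) / slope_factor f (t, y)) has_real_derivative ?u (x, y)) (at x)"
     "((\<lambda>t. h (x, t) / slope_factor f (x, t)) has_real_derivative ?v (x, y)) (at y)"
    if "(x, y) \<in> S" for x y
    using DERIV_divide_sqrt[OF C1_on_DERIV(1)[OF h that] dq(1)[OF that] q]
      DERIV_divide_sqrt[OF C1_on_DERIV(2)[OF h that] dq(2)[OF that] q]
    unfolding slope_factor_def q_def by simp_all
  have "continuous_on S ?u" "continuous_on S ?v"
    by (intro continuous_intros cont contq; use q in \<open>force simp: less_imp_neq[symmetric]\<close>)+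
  then show "C1_on S (\<lambda>p. h p / slope_factor f p)"
    using D by (intro C1_onI[where u="?u" and v="?v"])
  assume "p \<in> S"
  then show "Dx (\<lambda>p. h p / slope_factor f p) p = ?u p" "Dy (\<lambda>p. h p / slope_factor f p) p = ?v p"
    using Dx_eqI[OF D(1), of "fst p" "snd p"] Dy_eqI[OF D(2), of "fst p" "snd p"] by simp_all
qed

text \<open>Once the mixed partials are identified, the numerators over the common denominator add
  up to exactly the left side of the minimal surface equation.\<close>

lemma minimal_surface_flux_divergence_free:
  assumes f: "C2_on S f" and S: "open S" and mse: "minimal_surface_equation S f" and p: "p \<in> S"
  shows "Dx (\<lambda>p. Dx f p / slope_factor f p) p + Dy (\<lambda>p. Dy f p / slope_factor f p) p = 0"
proof -
  have C: "C1_on S (Dx f)" "C1_on S (Dy f)" using f by (auto simp: C2_on_def)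
  obtain x y where xy: "p = (x, y)" by (cases p)
  define q where "q = 1 + y\<^sup>2 * ((Dx f p)\<^sup>2 + (Dy f p)\<^sup>2)"
  have "(1 + y\<^sup>2 * (Dy f p)\<^sup>2) * Dx (Dx f) p - y * ((Dx f p)\<^sup>2 + (Dy f p)\<^sup>2) * Dy f p
      - 2 * y\<^sup>2 * Dx f p * Dy f p * Dy (Dx f) p + (1 + y\<^sup>2 * (Dx f p)\<^sup>2) * Dy (Dy f) p = 0"
    using mse p xy by (auto simp: minimal_surface_equation_def Let_def)
  then have "(Dx (Dx f) p * q - Dx f p * (y\<^sup>2 * (Dx f p * Dx (Dx f) p + Dy f p * Dy (Dx f) p)))
     + (Dy (Dy f) p * q - Dy f p * (y * ((Dx f p)\<^sup>2 + (Dy f p)\<^sup>2)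
         + y\<^sup>2 * (Dx f p * Dy (Dx f) p + Dy f p * Dy (Dy f) p))) = 0"
    unfolding q_def by algebra
  then show ?thesis
    unfolding Dx_divide_slope_factor[OF f C(1) S p] Dy_divide_slope_factor[OF f C(2) S p]
      C2_on_mixed_partials_commute[OF f S p, symmetric] add_divide_distrib[symmetric]
    by (simp add: xy q_def)
qed

section \<open>Cut-off functions\<close>

text \<open>Zero up to 0, then increasing to the limit 1. The squared positive part makes it C^1,
  which is all that a test function needs here, and a rational expression in it has an explicit
  derivative.\<close>

definition smooth_step :: "real \<Rightarrow> real" where
  "smooth_step s = (max 0 s)\<^sup>2 / (1 + (max 0 s)\<^sup>2)"

definition smooth_step' :: "real \<Rightarrow> real" where
  "smooth_step' s = 2 * max 0 s / (1 + (max 0 s)\<^sup>2)\<^sup>2"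

lemma DERIV_max_0_square: "((\<lambda>s. (max 0 s)\<^sup>2) has_real_derivative 2 * max 0 s) (at s)"
proof -
  consider "s < 0" | "s > 0" | "s = 0" by linarith
  then show ?thesis
  proof cases
    case 1
    then have "\<forall>\<^sub>F t in nhds s. (max 0 t)\<^sup>2 = 0"
      by (intro eventually_mono[OF eventually_nhds_in_open[of "{..<0}" s]]) auto
    from DERIV_cong_ev[OF refl this refl, of "2 * max 0 s"] 1 show ?thesis by simp
  next
    case 2
    then have "\<forall>\<^sub>F t in nhds s. (max 0 t)\<^sup>2 = t\<^sup>2"
      by (intro eventually_mono[OF eventually_nhds_in_open[of "{0<..}" s]]) auto
    then show ?thesis using 2
      by (simp add: DERIV_cong_ev[OF refl _ refl]) (auto intro!: derivative_eq_intros)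
  next
    case 3
    \<comment> \<open>For non-zero h the difference quotient at 0 is \<open>max 0 h\<close>
      itself.\<close>
    have "((\<lambda>h. max 0 h) \<longlongrightarrow> max 0 (0::real)) (at 0)" by (intro tendsto_intros)
    then have "((\<lambda>h. max 0 h) \<longlongrightarrow> (0::real)) (at 0)" by simp
    then have "((\<lambda>h::real. (max 0 h)\<^sup>2 / h) \<longlongrightarrow> 0) (at 0)"
      by (rule Lim_transform_eventually)
         (auto simp: eventually_at_filter max_def power2_eq_square)
    then show ?thesis using 3 by (simp add: DERIV_def)
  qed
qed

lemma one_plus_square_neq_0: "1 + x\<^sup>2 \<noteq> (0::real)"
  by (smt (verit) zero_le_power2)

lemma DERIV_smooth_step: "(smooth_step has_real_derivative smooth_step' s) (at s)"
  unfolding smooth_step_def[abs_def] smooth_step'_def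
  by (rule derivative_eq_intros DERIV_max_0_square refl one_plus_square_neq_0)+
     (use one_plus_square_neq_0[of "max 0 s"] in \<open>simp add: field_simps power2_eq_square\<close>)

lemma continuous_on_smooth_step': "continuous_on A smooth_step'"
  unfolding smooth_step'_def[abs_def]
  by (intro continuous_intros) (simp add: one_plus_square_neq_0)

lemma smooth_step_nonneg: "0 \<le> smooth_step s" and smooth_step_le_1: "smooth_step s \<le> 1"
  and smooth_step_eq_0: "s \<le> 0 \<Longrightarrow> smooth_step s = 0"
  and smooth_step'_nonneg: "0 \<le> smooth_step' s"
  and smooth_step'_eq_0: "s \<le> 0 \<Longrightarrow> smooth_step' s = 0"
  by (auto simp: smooth_step_def smooth_step'_def divide_le_eq_1 add_pos_nonneg intro!: divide_nonneg_nonneg)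

lemma smooth_step_tendsto_1: "(smooth_step \<longlongrightarrow> 1) at_top"
proof -
  have "((\<lambda>s::real. s\<^sup>2 / (1 + s\<^sup>2)) \<longlongrightarrow> 1) at_top" by real_asymp
  moreover have "\<forall>\<^sub>F s in at_top. s\<^sup>2 / (1 + s\<^sup>2) = smooth_step s"
    using eventually_ge_at_top[of "0::real"] by eventually_elim (simp add: smooth_step_def)
  ultimately show ?thesis by (rule Lim_transform_eventually)
qed

text \<open>The sign \<open>\<sigma>\<close> makes \<open>\<sigma> r'\<close> positive, so the integrand is at most the derivative of
  \<open>- \<sigma> k(- n r - 1) / m\<close>, where \<open>k\<close> is the step; this gives a bound independent of \<open>n\<close>.\<close>

lemma nn_integral_smooth_step_slice:
  fixes r r' :: "real \<Rightarrow> real"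
  assumes "c \<le> d" and D: "\<And>t. t \<in> {c..d} \<Longrightarrow> (r has_real_derivative r' t) (at t)"
    and cont: "continuous_on {c..d} r'" and \<sigma>: "\<bar>\<sigma>\<bar> = 1" and m: "m > 0" "\<And>t. t \<in> {c..d} \<Longrightarrow> m \<le> \<sigma> * r' t" and n: "n \<ge> 0"
  shows "(\<integral>\<^sup>+t. indicator {c..d} t * ennreal (n * smooth_step' (- n * r t - 1)) \<partial>lborel) \<le> ennreal (1 / m)"
proof -
  define v where "v = (\<lambda>t. n * smooth_step' (- n * r t - 1) * (\<sigma> * r' t) / m)"
  define F where "F = (\<lambda>t. - \<sigma> / m * smooth_step (- n * r t - 1))"
  have contr: "continuous_on {c..d} r"
    using D by (meson DERIV_isCont continuous_at_imp_continuous_on)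
  have "continuous_on {c..d} v"
    unfolding v_def using m(1)
    by (intro continuous_intros contr cont continuous_on_compose2[OF continuous_on_smooth_step'[of UNIV]]) auto
  then have meas: "(\<lambda>t. indicator {c..d} t *\<^sub>R v t) \<in> borel_measurable borel"
    by (intro borel_measurable_continuous_on_indicator) auto
  have DF: "(F has_real_derivative v t) (at t)" if t: "t \<in> {c..d}" for t
    unfolding F_def v_def
    by (rule derivative_eq_intros DERIV_chain2[OF DERIV_smooth_step] D[OF t] refl)+
       (use m(1) in \<open>simp add: field_simps\<close>)
  have "(\<integral>\<^sup>+t. indicator {c..d} t * ennreal (n * smooth_step' (- n * r t - 1)) \<partial>lborel)
      \<le> (\<integral>\<^sup>+t. ennreal (indicator {c..d} t *\<^sub>R v t) * indicator {c..d} t \<partial>lborel)"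
  proof (rule nn_integral_mono)
    fix t
    have "n * smooth_step' (- n * r t - 1) \<le> v t" if "t \<in> {c..d}"
    proof -
      have "0 \<le> n * smooth_step' (- n * r t - 1)" using n smooth_step'_nonneg by simp
      from mult_left_mono[OF m(2)[OF that] this] show ?thesis
        unfolding v_def using m(1) by (simp add: field_simps)
    qed
    then show "indicator {c..d} t * ennreal (n * smooth_step' (- n * r t - 1))
        \<le> ennreal (indicator {c..d} t *\<^sub>R v t) * indicator {c..d} t"
      by (auto simp: indicator_def intro: ennreal_leI)
  qed
  also have "\<dots> = ennreal (F d - F c)"
  proof (rule nn_integral_FTC_Icc[OF meas _ _ \<open>c \<le> d\<close>])
    fix t assume t: "t \<in> {c..d}"
    then show "(F has_real_derivative indicator {c..d} t *\<^sub>R v t) (at t)" using DF by simp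
    have "0 \<le> \<sigma> * r' t" using m t by fastforce
    then show "0 \<le> indicator {c..d} t *\<^sub>R v t"
      using n m(1) smooth_step'_nonneg t by (auto simp: v_def intro!: divide_nonneg_pos mult_nonneg_nonneg)
  qed
  also have "F d - F c \<le> 1 / m"
  proof -
    define \<delta> where "\<delta> = smooth_step (- n * r c - 1) - smooth_step (- n * r d - 1)"
    have "\<bar>\<delta>\<bar> \<le> 1"
      using smooth_step_nonneg smooth_step_le_1 unfolding \<delta>_def abs_le_iff by (smt (verit))
    then have "\<bar>\<sigma> * \<delta>\<bar> \<le> 1" using \<sigma> by (simp add: abs_mult)
    then have "\<sigma> * \<delta> \<le> 1" by linarith
    then have "\<sigma> * \<delta> / m \<le> 1 / m" using m(1) by (simp add: divide_right_mono)
    moreover have "F d - F c = \<sigma> * \<delta> / m"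
      by (simp add: F_def \<delta>_def right_diff_distrib diff_divide_distrib)
    ultimately show ?thesis by simp
  qed
  then have "ennreal (F d - F c) \<le> ennreal (1 / m)" by (rule ennreal_leI)
  finally show ?thesis .
qed

text \<open>Slicing along the direction of the partial that stays away from 0 reduces this to the
  one-dimensional bound, and the side across that direction contributes its length. Adding both side
  lengths gives one bound for both alternatives.\<close>

lemma nn_integral_smooth_step_box:
  assumes \<rho>: "C1_on U \<rho>" and "open U" and sub: "{a..b} \<times> {c..d} \<subseteq> U" and le: "a \<le> b" "c \<le> d"
    and \<sigma>: "\<bar>\<sigma>\<bar> = 1" and m: "m > 0" and n: "n \<ge> 0"
    and cases: "(\<forall>p\<in>{a..b} \<times> {c..d}. m \<le> \<sigma> * Dx \<rho> p) \<or> (\<forall>p\<in>{a..b} \<times> {c..d}. m \<le> \<sigma> * Dy \<rho> p)"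
  shows "(\<integral>\<^sup>+p. indicator ({a..b} \<times> {c..d}) p * ennreal (n * smooth_step' (- n * \<rho> p - 1)) \<partial>lborel)
    \<le> ennreal (((b - a) + (d - c)) / m)"
proof -
  define R where "R = {a..b} \<times> {c..d}"
  let ?h = "\<lambda>p. indicator R p * ennreal (n * smooth_step' (- n * \<rho> p - 1))"
  have "continuous_on R (\<lambda>p. n * smooth_step' (- n * \<rho> p - 1))"
    using continuous_on_subset[OF C1_on_imp_continuous_on[OF \<rho> \<open>open U\<close>] sub]
    by (auto simp: R_def intro!: continuous_intros continuous_on_compose2[OF continuous_on_smooth_step'[of UNIV]])
  moreover have "closed R" by (simp add: R_def closed_Times)
  ultimately have "(\<lambda>p. indicator R p *\<^sub>R (n * smooth_step' (- n * \<rho> p - 1))) \<in> borel_measurable borel"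
    by (intro borel_measurable_continuous_on_indicator) auto
  then have "(\<lambda>p. ennreal (indicator R p *\<^sub>R (n * smooth_step' (- n * \<rho> p - 1)))) \<in> borel_measurable borel"
    by measurable
  also have "(\<lambda>p. ennreal (indicator R p *\<^sub>R (n * smooth_step' (- n * \<rho> p - 1)))) = ?h"
    by (auto simp: indicator_def)
  finally have meas: "?h \<in> borel_measurable (lborel \<Otimes>\<^sub>M lborel)" by (simp add: lborel_prod)
  have int_const: "(\<integral>\<^sup>+x. indicator {l..u} x * ennreal (1 / m) \<partial>lborel) = ennreal ((u - l) / m)"
    if "l \<le> u" for l u :: real
    using that m by (simp add: nn_integral_multc ennreal_mult[symmetric])
  have ind: "indicator R (x, y) = (indicator {a..b} x * indicator {c..d} y :: ennreal)" for x y
    by (auto simp: R_def indicator_def)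
  have inU: "(x, y) \<in> U" if "x \<in> {a..b}" "y \<in> {c..d}" for x y
    using sub that by auto
  have contD: "continuous_on R (Dx \<rho>)" "continuous_on R (Dy \<rho>)"
    using \<rho> sub unfolding R_def C1_on_def by (blast intro: continuous_on_subset)+
  have nn: "0 \<le> (b - a) / m" "0 \<le> (d - c) / m" using le m by auto
  have "integral\<^sup>N lborel ?h \<le> ennreal (((b - a) + (d - c)) / m)" using cases
  proof
    assume D: "\<forall>p\<in>{a..b} \<times> {c..d}. m \<le> \<sigma> * Dx \<rho> p"
    have "integral\<^sup>N lborel ?h = (\<integral>\<^sup>+y. (\<integral>\<^sup>+x. ?h (x, y) \<partial>lborel) \<partial>lborel)"
      using lborel_pair.nn_integral_snd[OF meas] by (simp add: lborel_prod)
    also have "\<dots> \<le> (\<integral>\<^sup>+y. indicator {c..d} y * ennreal (1 / m) \<partial>lborel)"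
    proof (rule nn_integral_mono)
      fix y
      show "(\<integral>\<^sup>+x. ?h (x, y) \<partial>lborel) \<le> indicator {c..d} y * ennreal (1 / m)"
      proof (cases "y \<in> {c..d}")
        case True
        have "continuous_on {a..b} (\<lambda>x. Dx \<rho> (x, y))"
          by (rule continuous_on_compose2[OF contD(1)]) (use True in \<open>auto simp: R_def intro!: continuous_intros\<close>)
        then have "(\<integral>\<^sup>+x. indicator {a..b} x * ennreal (n * smooth_step' (- n * \<rho> (x, y) - 1)) \<partial>lborel) \<le> ennreal (1 / m)"
          by (intro nn_integral_smooth_step_slice[where r = "\<lambda>x. \<rho> (x, y)" and r' = "\<lambda>x. Dx \<rho> (x, y)",
                OF le(1) C1_on_DERIV(1)[OF \<rho>] _ \<sigma> m _ n])
             (use D inU True in auto)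
        then show ?thesis using True by (simp add: ind)
      qed (simp add: ind)
    qed
    also have "\<dots> \<le> ennreal (((b - a) + (d - c)) / m)"
      unfolding int_const[OF le(2)] using nn by (intro ennreal_leI) (simp add: add_divide_distrib)
    finally show ?thesis .
  next
    assume D: "\<forall>p\<in>{a..b} \<times> {c..d}. m \<le> \<sigma> * Dy \<rho> p"
    have "integral\<^sup>N lborel ?h = (\<integral>\<^sup>+x. (\<integral>\<^sup>+y. ?h (x, y) \<partial>lborel) \<partial>lborel)"
      using lborel.nn_integral_fst[OF meas] by (simp add: lborel_prod)
    also have "\<dots> \<le> (\<integral>\<^sup>+x. indicator {a..b} x * ennreal (1 / m) \<partial>lborel)"
    proof (rule nn_integral_mono)
      fix x
      show "(\<integral>\<^sup>+y. ?h (x, y) \<partial>lborel) \<le> indicator {a..b} x * ennreal (1 / m)"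
      proof (cases "x \<in> {a..b}")
        case True
        have "continuous_on {c..d} (\<lambda>y. Dy \<rho> (x, y))"
          by (rule continuous_on_compose2[OF contD(2)]) (use True in \<open>auto simp: R_def intro!: continuous_intros\<close>)
        then have "(\<integral>\<^sup>+y. indicator {c..d} y * ennreal (n * smooth_step' (- n * \<rho> (x, y) - 1)) \<partial>lborel) \<le> ennreal (1 / m)"
          by (intro nn_integral_smooth_step_slice[where r = "\<lambda>y. \<rho> (x, y)" and r' = "\<lambda>y. Dy \<rho> (x, y)",
                OF le(2) C1_on_DERIV(2)[OF \<rho>] _ \<sigma> m _ n])
             (use D inU True in auto)
        then show ?thesis using True by (simp add: ind)
      qed (simp add: ind)
    qed
    also have "\<dots> \<le> ennreal (((b - a) + (d - c)) / m)"
      unfolding int_const[OF le(1)] using nn by (intro ennreal_leI) (simp add: add_divide_distrib)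
    finally show ?thesis .
  qed
  then show ?thesis by (simp add: R_def)
qed

section \<open>Compactly supported bumps\<close>

definition bump :: "real \<Rightarrow> real" where
  "bump t = (max 0 (1 - t\<^sup>2))\<^sup>2"

definition bump' :: "real \<Rightarrow> real" where
  "bump' t = - 4 * t * max 0 (1 - t\<^sup>2)"

lemma DERIV_bump: "(bump has_real_derivative bump' t) (at t)"
proof -
  have "((\<lambda>t. 1 - t\<^sup>2) has_real_derivative - 2 * t) (at t)" by (auto intro!: derivative_eq_intros)
  from DERIV_chain2[OF DERIV_max_0_square this] show ?thesis
    by (simp add: bump_def[abs_def] bump'_def algebra_simps)
qed

lemma continuous_on_bump': "continuous_on A bump'"
  unfolding bump'_def[abs_def] by (intro continuous_intros)

lemma bump_nonneg: "0 \<le> bump t" by (simp add: bump_def)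

lemma bump_le_1: "bump t \<le> 1"
  by (simp add: bump_def power_le_one)

lemma bump_eq_0: "\<not> \<bar>t\<bar> \<le> 1 \<Longrightarrow> bump t = 0" and bump'_eq_0: "\<not> \<bar>t\<bar> \<le> 1 \<Longrightarrow> bump' t = 0"
  using one_less_power[of "\<bar>t\<bar>" 2] by (auto simp: bump_def bump'_def max_def)

lemma abs_bump'_le: "\<bar>bump' t\<bar> \<le> 4"
proof (cases "\<bar>t\<bar> \<le> 1")
  case True
  then have "\<bar>t\<bar> * max 0 (1 - t\<^sup>2) \<le> 1 * 1" by (intro mult_mono) auto
  then show ?thesis by (simp add: bump'_def abs_mult)
qed (simp add: bump'_eq_0)

lemma bump_ge_half: "\<bar>t\<bar> \<le> 1 / 2 \<Longrightarrow> bump t \<ge> 1 / 2"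
proof -
  assume "\<bar>t\<bar> \<le> 1 / 2"
  then have "t\<^sup>2 \<le> (1 / 2)\<^sup>2" by (metis abs_ge_zero power2_abs power_mono)
  then have "t\<^sup>2 \<le> 1 / 4" by (simp add: power_divide)
  then have ge: "3 / 4 \<le> max 0 (1 - t\<^sup>2)" by linarith
  have "(3 / 4)\<^sup>2 \<le> bump t" unfolding bump_def by (rule power_mono[OF ge]) simp
  moreover have "(3 / 4)\<^sup>2 = (9 / 16 :: real)" by (simp add: power_divide)
  ultimately show ?thesis by linarith
qed

section \<open>Finiteness of the area\<close>

text \<open>Testing with \<open>\<eta>\<close> times \<open>f\<close> shows that the integral of
  \<open>\<eta>\<close> flux . grad f is minus that of f flux . grad \<open>\<eta>\<close>. When the
  field is the flux of \<open>f\<close>, the gradient of \<open>f\<close> enters the second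
  integrand only through this bounded field, so a majorant \<open>h\<close> can be found without
  controlling that gradient.\<close>

lemma nn_integral_test_function_bound:
  assumes P: "C1_on S P" and Q: "C1_on S Q" and div: "\<And>p. p \<in> S \<Longrightarrow> Dx P p + Dy Q p = 0"
    and f: "C1_on S f" and \<eta>: "C1_on S \<eta>" and S: "open S"
    and K: "compact K" "K \<subseteq> S" "\<And>p. p \<in> S - K \<Longrightarrow> \<eta> p = 0"
    and nonneg: "\<And>p. p \<in> S \<Longrightarrow> 0 \<le> \<eta> p * (P p * Dx f p + Q p * Dy f p)"
    and h: "\<And>p. p \<in> S \<Longrightarrow> \<bar>f p * (P p * Dx \<eta> p + Q p * Dy \<eta> p)\<bar> \<le> h p"
  shows "(\<lambda>p. indicator S p * (\<eta> p * (P p * Dx f p + Q p * Dy f p))) \<in> borel_measurable lborel"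
    and "(\<integral>\<^sup>+p. ennreal (indicator S p * (\<eta> p * (P p * Dx f p + Q p * Dy f p))) \<partial>lborel)
      \<le> (\<integral>\<^sup>+p. indicator S p * ennreal (h p) \<partial>lborel)"
proof -
  let ?A = "\<lambda>p. indicator S p * (\<eta> p * (P p * Dx f p + Q p * Dy f p))"
  let ?B = "\<lambda>p. indicator S p * (f p * (P p * Dx \<eta> p + Q p * Dy \<eta> p))"
  let ?T = "\<lambda>p. indicator S p * (P p * Dx (\<lambda>p. \<eta> p * f p) p + Q p * Dy (\<lambda>p. \<eta> p * f p) p)"
  have "continuous_on S (\<lambda>p. \<eta> p * (P p * Dx f p + Q p * Dy f p))"
    using f C1_on_imp_continuous_on[OF _ S] P Q \<eta> unfolding C1_on_def by (intro continuous_intros) blast+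
  then have "integrable lborel (\<lambda>p. indicator K p *\<^sub>R (\<eta> p * (P p * Dx f p + Q p * Dy f p)))"
    using K by (intro borel_integrable_compact) (auto intro: continuous_on_subset)
  also have "(\<lambda>p. indicator K p *\<^sub>R (\<eta> p * (P p * Dx f p + Q p * Dy f p))) = ?A"
    using K by (fastforce simp: indicator_def fun_eq_iff)
  finally have A: "integrable lborel ?A" .
  then show "?A \<in> borel_measurable lborel" by (rule borel_measurable_integrable)
  have 0: "\<eta> p * f p = 0" if "p \<in> S - K" for p using K(3)[OF that] by simp
  note T = integral_divergence_free[OF P Q div C1_on_mult[OF \<eta> f S] S K(1,2) 0]
  have eq: "?T p = ?A p + ?B p" for p
    by (cases "p \<in> S") (simp_all add: Dx_mult[OF \<eta> f S] Dy_mult[OF \<eta> f S] algebra_simps)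
  have "integrable lborel (\<lambda>p. ?T p - ?A p)" using T(1) A by (rule Bochner_Integration.integrable_diff)
  then have B: "integrable lborel ?B" unfolding eq by simp
  have "integral\<^sup>L lborel ?A + integral\<^sup>L lborel ?B = 0"
    using T(2) Bochner_Integration.integral_add[OF A B] unfolding eq by simp
  then have le: "integral\<^sup>L lborel ?A \<le> norm (integral\<^sup>L lborel ?B)" by (simp add: abs_if)
  have "(\<integral>\<^sup>+p. ennreal (?A p) \<partial>lborel) = ennreal (integral\<^sup>L lborel ?A)"
    by (rule nn_integral_eq_integral[OF A]) (use nonneg in \<open>auto simp: indicator_def\<close>)
  also have "\<dots> \<le> ennreal (norm (integral\<^sup>L lborel ?B))" using le by (rule ennreal_leI)
  also have "\<dots> \<le> (\<integral>\<^sup>+p. ennreal (norm (?B p)) \<partial>lborel)" by (rule integral_norm_bound_ennreal[OF B])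
  also have "\<dots> \<le> (\<integral>\<^sup>+p. indicator S p * ennreal (h p) \<partial>lborel)"
    by (rule nn_integral_mono) (use h in \<open>auto simp: indicator_def intro!: ennreal_leI\<close>)
  finally show "(\<integral>\<^sup>+p. ennreal (?A p) \<partial>lborel) \<le> (\<integral>\<^sup>+p. indicator S p * ennreal (h p) \<partial>lborel)" .
qed

text \<open>Supported in a square with sides parallel to the axes, the shape on which the boundary
  cut-off is integrated slice by slice.\<close>

definition box_bump :: "real \<times> real \<Rightarrow> real \<Rightarrow> real \<times> real \<Rightarrow> real" where
  "box_bump c r p = bump ((fst p - fst c) / r) * bump ((snd p - snd c) / r)"

lemma
  assumes "r > 0"
  shows C1_on_box_bump: "C1_on S (box_bump c r)"
    and Dx_box_bump: "Dx (box_bump c r) p = bump' ((fst p - fst c) / r) / r * bump ((snd p - snd c) / r)"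
    and Dy_box_bump: "Dy (box_bump c r) p = bump ((fst p - fst c) / r) * (bump' ((snd p - snd c) / r) / r)"
proof -
  let ?u = "\<lambda>p. bump' ((fst p - fst c) / r) / r * bump ((snd p - snd c) / r)"
  let ?v = "\<lambda>p. bump ((fst p - fst c) / r) * (bump' ((snd p - snd c) / r) / r)"
  have lin: "((\<lambda>t. (t - k) / r) has_real_derivative 1 / r) (at t)" for k t
    by (rule derivative_eq_intros refl)+ (use assms in auto)
  have D: "((\<lambda>t. bump ((t - k) / r)) has_real_derivative bump' ((t - k) / r) / r) (at t)" for k t
    using DERIV_chain2[OF DERIV_bump lin, of k t] by simp
  have "((\<lambda>t. box_bump c r (t, y)) has_real_derivative ?u (x, y)) (at x)"
    "((\<lambda>t. box_bump c r (x, t)) has_real_derivative ?v (x, y)) (at y)" for x y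
    unfolding box_bump_def using DERIV_cmult_right[OF D] DERIV_cmult[OF D] by simp_all
  note DD = this
  have contb: "continuous_on A bump" for A
    by (meson DERIV_bump DERIV_isCont continuous_at_imp_continuous_on)
  have "continuous_on S ?u" "continuous_on S ?v"
    by (intro continuous_intros continuous_on_compose2[OF contb[of UNIV]]
        continuous_on_compose2[OF continuous_on_bump'[of UNIV]]; use assms in simp)+
  then show "C1_on S (box_bump c r)"
    by (rule C1_onI[where u="?u" and v="?v", OF DD])
  show "Dx (box_bump c r) p = ?u p" "Dy (box_bump c r) p = ?v p"
    using Dx_eqI[OF DD(1), of "fst p" "snd p"] Dy_eqI[OF DD(2), of "fst p" "snd p"] by simp_all
qed

lemma box_bump_nonneg: "0 \<le> box_bump c r p"
  by (simp add: box_bump_def bump_nonneg)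

lemma box_bump_le_1: "box_bump c r p \<le> 1"
  unfolding box_bump_def using mult_mono[OF bump_le_1 bump_le_1] bump_nonneg by fastforce

lemma abs_bump_le_1: "\<bar>bump t\<bar> \<le> 1"
  using bump_nonneg[of t] bump_le_1[of t] by simp

lemma
  assumes "r > 0"
  shows abs_Dx_box_bump_le: "\<bar>Dx (box_bump c r) p\<bar> \<le> 4 / r"
    and abs_Dy_box_bump_le: "\<bar>Dy (box_bump c r) p\<bar> \<le> 4 / r"
proof -
  have "\<bar>bump' s / r * bump t\<bar> \<le> 4 / r * 1" "\<bar>bump t * (bump' s / r)\<bar> \<le> 1 * (4 / r)" for s t
    unfolding abs_mult using assms abs_bump'_le[of s] abs_bump_le_1[of t]
    by (intro mult_mono; simp add: divide_right_mono)+
  then show "\<bar>Dx (box_bump c r) p\<bar> \<le> 4 / r" "\<bar>Dy (box_bump c r) p\<bar> \<le> 4 / r"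
    unfolding Dx_box_bump[OF assms] Dy_box_bump[OF assms] by simp_all
qed

lemma
  assumes "r > 0" "p \<notin> {fst c - r..fst c + r} \<times> {snd c - r..snd c + r}"
  shows box_bump_eq_0: "box_bump c r p = 0" and Dx_box_bump_eq_0: "Dx (box_bump c r) p = 0"
    and Dy_box_bump_eq_0: "Dy (box_bump c r) p = 0"
proof -
  have "\<not> \<bar>(fst p - fst c) / r\<bar> \<le> 1 \<or> \<not> \<bar>(snd p - snd c) / r\<bar> \<le> 1"
    using assms by (auto simp: mem_Times_iff abs_divide divide_le_eq abs_le_iff)
  then show "box_bump c r p = 0" "Dx (box_bump c r) p = 0" "Dy (box_bump c r) p = 0"
    unfolding Dx_box_bump[OF assms(1)] Dy_box_bump[OF assms(1)] box_bump_def
    using bump_eq_0 bump'_eq_0 by auto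
qed

lemma box_bump_ge_quarter:
  assumes "r > 0" "p \<in> {fst c - r/2<..<fst c + r/2} \<times> {snd c - r/2<..<snd c + r/2}"
  shows "1 / 4 \<le> box_bump c r p"
proof -
  have "\<bar>fst p - fst c\<bar> \<le> r / 2" "\<bar>snd p - snd c\<bar> \<le> r / 2"
    using assms(2) unfolding mem_Times_iff greaterThanLessThan_iff by linarith+
  then have "\<bar>(fst p - fst c) / r\<bar> \<le> 1 / 2" "\<bar>(snd p - snd c) / r\<bar> \<le> 1 / 2"
    using \<open>r > 0\<close> by (simp_all add: abs_divide divide_le_eq)
  then have "1 / 2 * (1 / 2) \<le> box_bump c r p"
    unfolding box_bump_def by (intro mult_mono bump_ge_half) (auto simp: bump_nonneg)
  then show ?thesis by simp
qed

text \<open>At \<open>c\<close> the larger partial of \<open>\<rho>\<close> has absolute value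
  \<open>2 * m\<close>. On a square where both partials move by less than \<open>m\<close> it keeps
  its sign \<open>\<sigma>\<close> and stays at least \<open>m\<close> in size, while both partials
  stay within \<open>3 * m\<close>. The bound \<open>r \<le> snd c / 2\<close> keeps the square off
  the line y = 0.\<close>

lemma boundary_chart_box:
  assumes "C1_boundary \<Omega>" "c \<in> frontier \<Omega>" "snd c > 0"
  obtains U \<rho> r \<sigma> m L where "open U" "C1_on U \<rho>" "\<Omega> \<inter> U = {q \<in> U. \<rho> q < 0}"
    "r > 0" "r \<le> snd c / 2" "{fst c - r..fst c + r} \<times> {snd c - r..snd c + r} \<subseteq> U" "m > 0" "\<bar>\<sigma>\<bar> = (1::real)"
    "\<And>p. p \<in> {fst c - r..fst c + r} \<times> {snd c - r..snd c + r} \<Longrightarrow> \<bar>Dx \<rho> p\<bar> \<le> L \<and> \<bar>Dy \<rho> p\<bar> \<le> L"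
    "(\<forall>p\<in>{fst c - r..fst c + r} \<times> {snd c - r..snd c + r}. m \<le> \<sigma> * Dx \<rho> p)
      \<or> (\<forall>p\<in>{fst c - r..fst c + r} \<times> {snd c - r..snd c + r}. m \<le> \<sigma> * Dy \<rho> p)"
proof -
  obtain U \<rho> where U: "open U" "c \<in> U" "C1_on U \<rho>" "(Dx \<rho> c, Dy \<rho> c) \<noteq> (0, 0)"
     "\<Omega> \<inter> U = {q \<in> U. \<rho> q < 0}"
    using assms(1,2) unfolding C1_boundary_def by blast
  define m where "m = max \<bar>Dx \<rho> c\<bar> \<bar>Dy \<rho> c\<bar> / 2"
  have m: "m > 0" using U(4) by (auto simp: m_def)
  have "isCont (Dx \<rho>) c" "isCont (Dy \<rho>) c"
    using U(1-3) by (auto simp: C1_on_def continuous_on_eq_continuous_at)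
  then obtain d1 d2 where d: "d1 > 0" "d2 > 0"
      "\<And>q. dist q c < d1 \<Longrightarrow> dist (Dx \<rho> q) (Dx \<rho> c) < m"
      "\<And>q. dist q c < d2 \<Longrightarrow> dist (Dy \<rho> q) (Dy \<rho> c) < m"
    using m unfolding continuous_at_eps_delta by metis
  obtain d0 where d0: "d0 > 0" "ball c d0 \<subseteq> U" using U(1,2) by (rule openE)
  define r where "r = min (snd c) (min d0 (min d1 d2)) / 3"
  have r: "r > 0" "r \<le> snd c / 2" using d d0 assms(3) by (auto simp: r_def)
  define R where "R = {fst c - r..fst c + r} \<times> {snd c - r..snd c + r}"
  have near: "dist q c < d0 \<and> dist q c < d1 \<and> dist q c < d2" if "q \<in> R" for q
  proof -
    have "dist q c \<le> dist (fst q) (fst c) + dist (snd q) (snd c)"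
      unfolding dist_prod_def by (rule sqrt_sum_squares_le_sum) auto
    also have "\<dots> \<le> 2 * r" using that by (auto simp: dist_real_def R_def)
    also have "\<dots> < 3 * r" using r by simp
    finally show ?thesis unfolding r_def by simp
  qed
  have RU: "R \<subseteq> U" using near d0 by (auto simp: dist_commute subset_iff)
  have close: "\<bar>Dx \<rho> q - Dx \<rho> c\<bar> < m \<and> \<bar>Dy \<rho> q - Dy \<rho> c\<bar> < m" if "q \<in> R" for q
    using near[OF that] d(3,4) by (auto simp: dist_real_def)
  have mm: "\<bar>Dx \<rho> c\<bar> \<le> 2 * m" "\<bar>Dy \<rho> c\<bar> \<le> 2 * m" by (auto simp: m_def)
  have L: "\<bar>Dx \<rho> q\<bar> \<le> 3 * m \<and> \<bar>Dy \<rho> q\<bar> \<le> 3 * m" if "q \<in> R" for q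
    using close[OF that] mm by linarith
  \<comment> \<open>Here \<open>e\<close> stands for the dominant partial at \<open>c\<close>, and
    \<open>\<sigma>\<close> is its sign.\<close>
  have sel: "\<exists>\<sigma>. \<bar>\<sigma>\<bar> = 1 \<and> (\<forall>d. \<bar>d - e\<bar> < m \<longrightarrow> m \<le> \<sigma> * d)" if "\<bar>e\<bar> = 2 * m" for e :: real
    using that by (intro exI[of _ "if e > 0 then 1 else - 1"]) (auto simp: abs_if split: if_splits)
  have "\<bar>Dx \<rho> c\<bar> = 2 * m \<or> \<bar>Dy \<rho> c\<bar> = 2 * m" by (auto simp: m_def)
  then have "\<exists>\<sigma>. \<bar>\<sigma>\<bar> = 1 \<and> ((\<forall>p\<in>R. m \<le> \<sigma> * Dx \<rho> p) \<or> (\<forall>p\<in>R. m \<le> \<sigma> * Dy \<rho> p))"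
    using sel close by meson
  then obtain \<sigma> where "\<bar>\<sigma>\<bar> = 1" "(\<forall>p\<in>R. m \<le> \<sigma> * Dx \<rho> p) \<or> (\<forall>p\<in>R. m \<le> \<sigma> * Dy \<rho> p)" by blast
  then show ?thesis
    using that[of U \<rho> r m \<sigma> "3 * m"] U r m L RU unfolding R_def by blast
qed

section \<open>Pointwise inequalities between area density and flux\<close>

definition area_density :: "(real \<times> real \<Rightarrow> real) \<Rightarrow> real \<times> real \<Rightarrow> real" where
  "area_density f p = slope_factor f p / (snd p)\<^sup>2"

lemma area_density_nonneg: "0 \<le> area_density f p"
  using slope_factor_pos[of f p] by (simp add: area_density_def)

lemma abs_mult_le_slope_factor:
  assumes "snd p > 0"
  shows "snd p * \<bar>Dx f p\<bar> \<le> slope_factor f p" "snd p * \<bar>Dy f p\<bar> \<le> slope_factor f p"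
proof -
  have "(snd p * \<bar>Dx f p\<bar>)\<^sup>2 \<le> (slope_factor f p)\<^sup>2" "(snd p * \<bar>Dy f p\<bar>)\<^sup>2 \<le> (slope_factor f p)\<^sup>2"
    unfolding slope_factor_square by (auto simp: power_mult_distrib algebra_simps intro!: add_nonneg_nonneg)
  then show "snd p * \<bar>Dx f p\<bar> \<le> slope_factor f p" "snd p * \<bar>Dy f p\<bar> \<le> slope_factor f p"
    using slope_factor_pos[of f p] by (auto dest: power2_le_imp_le)
qed

text \<open>The flux saturates: as the graph gets steeper, its gradient and
  \<open>slope_factor\<close> grow at the same rate, and the quotient stays below a quantity
  depending on y only.\<close>

lemma abs_flux_le:
  assumes "snd p > 0"
  shows "\<bar>Dx f p / slope_factor f p\<bar> \<le> 1 / snd p" "\<bar>Dy f p / slope_factor f p\<bar> \<le> 1 / snd p"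
  using abs_mult_le_slope_factor[OF assms, of f] assms slope_factor_pos[of f p]
  by (simp_all add: field_simps)

lemma flux_gradient_nonneg: "0 \<le> Dx f p / slope_factor f p * Dx f p + Dy f p / slope_factor f p * Dy f p"
  using slope_factor_pos[of f p] by (simp add: power2_eq_square[symmetric])

text \<open>For e = |grad f|^2, the identity W^2 = 1 + y^2 e gives W = 1/W + y^2 (e/W), where 1/W is
  at most 1 and e/W is flux . grad f. So finite area away from y = 0 follows from a bound on the
  integral of flux . grad f, the quantity that test functions control.\<close>

lemma area_density_le_flux_gradient:
  assumes "snd p > 0"
  shows "area_density f p
    \<le> 1 / (snd p)\<^sup>2 + (Dx f p / slope_factor f p * Dx f p + Dy f p / slope_factor f p * Dy f p)"
proof -
  define w where "w = slope_factor f p"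
  have w: "w \<ge> 1" by (simp add: w_def slope_factor_ge_1)
  define e where "e = (Dx f p)\<^sup>2 + (Dy f p)\<^sup>2"
  define y where "y = snd p"
  have y: "y > 0" using assms y_def by simp
  have "w * w = 1 + y\<^sup>2 * e" using slope_factor_square[of f p] by (simp add: w_def e_def y_def power2_eq_square)
  then have "w = (1 + y\<^sup>2 * e) / w" using w by (simp add: field_simps)
  also have "\<dots> = 1 / w + y\<^sup>2 * (e / w)" by (simp add: add_divide_distrib)
  also have "\<dots> \<le> 1 + y\<^sup>2 * (e / w)" using w by simp
  finally have "w / y\<^sup>2 \<le> (1 + y\<^sup>2 * (e / w)) / y\<^sup>2" using y by (simp add: divide_right_mono)
  also have "\<dots> = 1 / y\<^sup>2 + e / w" using y by (simp add: field_simps)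
  finally show ?thesis
    by (simp add: area_density_def w_def[symmetric] y_def[symmetric] e_def add_divide_distrib power2_eq_square)
qed

text \<open>Testing bounds the integral of flux . grad f near \<open>c\<close> uniformly in the
  cut-off parameter; the cut-offs tend to 1 inside \<open>\<Omega>\<close>, and Fatou's lemma
  removes them. The neighbourhood obtained is the half-size square \<open>V\<close>, where the bump
  is at least 1/4.\<close>

lemma finite_area_near_boundary:
  assumes \<Omega>: "open \<Omega>" "C1_boundary \<Omega>" and c: "c \<in> frontier \<Omega>" "snd c > 0"
    and f: "C2_on \<Omega> f" and mse: "minimal_surface_equation \<Omega> f" and bound: "\<And>p. p \<in> \<Omega> \<Longrightarrow> \<bar>f p\<bar> \<le> M"
  shows "\<exists>V. open V \<and> c \<in> V \<and> (\<integral>\<^sup>+p. indicator (\<Omega> \<inter> V) p * ennreal (area_density f p) \<partial>lborel) < \<infinity>"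
proof -
  obtain U \<rho> r \<sigma> m L where U: "open U" "C1_on U \<rho>" "\<Omega> \<inter> U = {q \<in> U. \<rho> q < 0}"
    and r: "r > 0" "r \<le> snd c / 2"
    and RU: "{fst c - r..fst c + r} \<times> {snd c - r..snd c + r} \<subseteq> U" and m: "m > 0" and \<sigma>: "\<bar>\<sigma>\<bar> = (1::real)"
    and L: "\<And>p. p \<in> {fst c - r..fst c + r} \<times> {snd c - r..snd c + r} \<Longrightarrow> \<bar>Dx \<rho> p\<bar> \<le> L \<and> \<bar>Dy \<rho> p\<bar> \<le> L"
    and sel: "(\<forall>p\<in>{fst c - r..fst c + r} \<times> {snd c - r..snd c + r}. m \<le> \<sigma> * Dx \<rho> p)
      \<or> (\<forall>p\<in>{fst c - r..fst c + r} \<times> {snd c - r..snd c + r}. m \<le> \<sigma> * Dy \<rho> p)"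
    by (rule boundary_chart_box[OF \<Omega>(2) c]) (rule that)
  define R where "R = {fst c - r..fst c + r} \<times> {snd c - r..snd c + r}"
  define S where "S = \<Omega> \<inter> U"
  define V where "V = {fst c - r/2<..<fst c + r/2} \<times> {snd c - r/2<..<snd c + r/2}"
  define P where "P = (\<lambda>p. Dx f p / slope_factor f p)"
  define Q where "Q = (\<lambda>p. Dy f p / slope_factor f p)"
  define g where "g = (\<lambda>p. P p * Dx f p + Q p * Dy f p)"
  \<comment> \<open>A lower bound for y on \<open>R\<close>, by \<open>r \<le> snd c / 2\<close>; it
    turns the bound 1/y for the flux into a constant.\<close>
  define y0 where "y0 = snd c / 2"
  have y0: "y0 > 0" using c by (simp add: y0_def)
  have R_y: "y0 \<le> snd p" if "p \<in> R" for p using that r by (auto simp: R_def y0_def)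
  have S: "open S" "S \<subseteq> \<Omega>" "S \<subseteq> U" using open_Int[OF \<Omega>(1) U(1)] by (simp_all only: S_def Int_lower1 Int_lower2)
  have "R \<subseteq> U" using RU by (simp add: R_def)
  have fS: "C2_on S f" "C1_on S f" "C1_on S (Dx f)" "C1_on S (Dy f)"
    using f S(2) C1_on_subset unfolding C2_on_def by blast+
  have mseS: "minimal_surface_equation S f"
    using mse S(2) unfolding minimal_surface_equation_def by blast
  have PQ: "C1_on S P" "C1_on S Q"
    unfolding P_def Q_def by (intro C1_on_divide_slope_factor fS S)+
  have div: "Dx P p + Dy Q p = 0" if "p \<in> S" for p
    unfolding P_def Q_def by (rule minimal_surface_flux_divergence_free[OF fS(1) S(1) mseS that])
  have g_nonneg: "0 \<le> g p" for p unfolding g_def P_def Q_def by (rule flux_gradient_nonneg)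
  define M' where "M' = max M 0"
  have M': "M' \<ge> 0" "\<And>p. p \<in> S \<Longrightarrow> \<bar>f p\<bar> \<le> M'"
    using S(2) by (auto simp: M'_def intro!: max.coboundedI1 bound)
  \<comment> \<open>With \<open>Suc n\<close> in place of \<open>n\<close>, the level
    \<open>- 1 / N n\<close> in \<open>K\<close> is negative from the start.\<close>
  define N where "N = (\<lambda>n. real (Suc n))"
  have N: "N n > 0" for n by (simp add: N_def)
  define \<kappa> where "\<kappa> = (\<lambda>n p. smooth_step (- N n * \<rho> p - 1))"
  define \<eta> where "\<eta> = (\<lambda>n p. box_bump c r p * \<kappa> n p)"
  have dphi: "((\<lambda>t. smooth_step (- N n * t - 1)) has_real_derivative - N n * smooth_step' (- N n * t - 1)) (at t)" for n t
  proof -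
    have "((\<lambda>t. - N n * t - 1) has_real_derivative - N n) (at t)" by (auto intro!: derivative_eq_intros)
    from DERIV_chain2[OF DERIV_smooth_step this] show ?thesis by (simp only: mult.commute)
  qed
  have contphi: "continuous_on UNIV (\<lambda>t. - N n * smooth_step' (- N n * t - 1))" for n
    by (intro continuous_intros continuous_on_compose2[OF continuous_on_smooth_step'[of UNIV]]) auto
  have \<rho>S: "C1_on S \<rho>" using U(2) S(3) by (rule C1_on_subset)
  have \<kappa>: "C1_on S (\<kappa> n)" for n
    unfolding \<kappa>_def by (rule C1_on_comp[OF \<rho>S S(1) dphi contphi])
  have D\<kappa>: "Dx (\<kappa> n) p = - N n * smooth_step' (- N n * \<rho> p - 1) * Dx \<rho> p"
     "Dy (\<kappa> n) p = - N n * smooth_step' (- N n * \<rho> p - 1) * Dy \<rho> p" if "p \<in> S" for n p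
    using Dx_comp[OF \<rho>S S(1) dphi contphi that] Dy_comp[OF \<rho>S S(1) dphi contphi that]
    unfolding \<kappa>_def by simp_all
  note bumpS = C1_on_box_bump[OF r(1), of S c]
  have \<eta>: "C1_on S (\<eta> n)" for n unfolding \<eta>_def by (rule C1_on_mult[OF bumpS \<kappa> S(1)])
  have \<eta>_nonneg: "0 \<le> \<eta> n p" for n p
    by (simp add: \<eta>_def \<kappa>_def box_bump_nonneg smooth_step_nonneg)
  \<comment> \<open>The cut-off \<open>\<kappa> n\<close> vanishes where
    \<open>\<rho> p \<ge> - 1 / N n\<close>. The closed condition makes \<open>K n\<close> compact,
    and the negative level keeps it inside \<open>\<Omega>\<close> although \<open>R\<close> reaches
    across the boundary.\<close>
  define K where "K = (\<lambda>n. {p \<in> R. \<rho> p \<le> - 1 / N n})"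
  have "compact R" by (simp add: R_def compact_Times)
  have cont\<rho>: "continuous_on R \<rho>"
    using C1_on_imp_continuous_on[OF U(2,1)] \<open>R \<subseteq> U\<close> by (rule continuous_on_subset)
  have K: "compact (K n)" "K n \<subseteq> S" "\<And>p. p \<in> S - K n \<Longrightarrow> \<eta> n p = 0" for n
  proof -
    have "closed (R \<inter> \<rho> -` {..- 1 / N n})"
      by (intro continuous_closed_preimage cont\<rho> compact_imp_closed[OF \<open>compact R\<close>] closed_atMost)
    from compact_Int_closed[OF \<open>compact R\<close> this] show "compact (K n)"
      by (simp add: K_def Int_def vimage_def)
    have "\<rho> p < 0" if "p \<in> K n" for p using that N[of n] by (auto simp: K_def intro: le_less_trans)
    then show "K n \<subseteq> S" using U(3) \<open>R \<subseteq> U\<close> unfolding S_def K_def by blast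
    show "\<eta> n p = 0" if p: "p \<in> S - K n" for p
    proof (cases "p \<in> R")
      case True
      then have "- N n * \<rho> p - 1 \<le> 0" using p N[of n] by (auto simp: K_def field_simps)
      then show ?thesis by (simp add: \<eta>_def \<kappa>_def smooth_step_eq_0)
    next
      case False
      then show ?thesis using box_bump_eq_0[OF r(1)] by (simp add: \<eta>_def R_def)
    qed
  qed
  \<comment> \<open>The product rule for \<open>\<eta> n\<close> yields two partials of the bump,
    each at most 4/r, and two of the cut-off, each at most \<open>L\<close> times the factor with
    \<open>N n\<close>. The prefactor \<open>M' / y0\<close> bounds \<open>f\<close> times a
    component of the flux.\<close>
  define h where "h = (\<lambda>n p. indicator R p * (M' / y0 * (8 / r))
      + M' / y0 * (2 * L) * (indicator R p * (N n * smooth_step' (- N n * \<rho> p - 1))))"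
  have R_ne: "c \<in> R" using r by (auto simp: R_def mem_Times_iff)
  have "L \<ge> 0" using L[OF R_ne[unfolded R_def]] by linarith
  have h: "\<bar>f p * (P p * Dx (\<eta> n) p + Q p * Dy (\<eta> n) p)\<bar> \<le> h n p" if p: "p \<in> S" for n p
  proof (cases "p \<in> R")
    case True
    define k where "k = N n * smooth_step' (- N n * \<rho> p - 1)"
    have k: "k \<ge> 0" using N[of n] smooth_step'_nonneg by (simp add: k_def)
    \<comment> \<open>One estimate for both partials: \<open>b\<close> and \<open>b'\<close> are the
      bump and its partial, \<open>d\<close> is the partial of \<open>\<rho>\<close>, and
      \<open>q\<close> is the value of the cut-off.\<close>
    have step: "\<bar>b * - k * d + b' * q\<bar> \<le> 4 / r + L * k"
      if "0 \<le> b" "b \<le> 1" "\<bar>d\<bar> \<le> L" "\<bar>b'\<bar> \<le> 4 / r" "0 \<le> q" "q \<le> 1" for b d b' q :: real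
    proof -
      have "\<bar>b * - k * d\<bar> \<le> 1 * k * L" unfolding abs_mult using that k by (intro mult_mono) auto
      moreover have "\<bar>b' * q\<bar> \<le> 4 / r * 1" unfolding abs_mult using that r(1) by (intro mult_mono) auto
      ultimately show ?thesis by (simp add: mult.commute)
    qed
    have "\<bar>Dx (\<eta> n) p\<bar> \<le> 4 / r + L * k" "\<bar>Dy (\<eta> n) p\<bar> \<le> 4 / r + L * k"
      unfolding \<eta>_def Dx_mult[OF bumpS \<kappa> S(1) p] Dy_mult[OF bumpS \<kappa> S(1) p] D\<kappa>[OF p]
      using step[OF box_bump_nonneg box_bump_le_1 _ abs_Dx_box_bump_le[OF r(1)], of _ "\<kappa> n p"]
        step[OF box_bump_nonneg box_bump_le_1 _ abs_Dy_box_bump_le[OF r(1)], of _ "\<kappa> n p"]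
        L True smooth_step_nonneg smooth_step_le_1 unfolding R_def k_def \<kappa>_def by (simp_all add: mult.assoc)
    note D\<eta> = this
    have yp: "snd p > 0" "1 / snd p \<le> 1 / y0" using R_y[OF True] y0 by (auto simp: frac_le)
    have "\<bar>P p\<bar> \<le> 1 / y0" "\<bar>Q p\<bar> \<le> 1 / y0"
      using abs_flux_le[OF yp(1), of f] yp(2) unfolding P_def Q_def by linarith+
    then have "\<bar>P p * Dx (\<eta> n) p\<bar> \<le> 1 / y0 * (4 / r + L * k)" "\<bar>Q p * Dy (\<eta> n) p\<bar> \<le> 1 / y0 * (4 / r + L * k)"
      unfolding abs_mult using D\<eta> y0 by (intro mult_mono; simp)+
    then have "\<bar>P p * Dx (\<eta> n) p + Q p * Dy (\<eta> n) p\<bar> \<le> 2 * (1 / y0 * (4 / r + L * k))" by linarith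
    then have "\<bar>f p * (P p * Dx (\<eta> n) p + Q p * Dy (\<eta> n) p)\<bar> \<le> M' * (2 * (1 / y0 * (4 / r + L * k)))"
      unfolding abs_mult using M'(1) M'(2)[OF p] by (intro mult_mono) auto
    also have "\<dots> = M' / y0 * (8 / r) + M' / y0 * (2 * L) * k" using y0 r(1) by (simp add: field_simps)
    finally show ?thesis using True by (simp add: h_def k_def)
  next
    case False
    have "Dx (\<eta> n) p = 0" "Dy (\<eta> n) p = 0"
      unfolding \<eta>_def Dx_mult[OF bumpS \<kappa> S(1) p] Dy_mult[OF bumpS \<kappa> S(1) p]
      using box_bump_eq_0[OF r(1) False[unfolded R_def]] Dx_box_bump_eq_0[OF r(1) False[unfolded R_def]]
        Dy_box_bump_eq_0[OF r(1) False[unfolded R_def]] by simp_all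
    then show ?thesis using False by (simp add: h_def)
  qed
  \<comment> \<open>Free of \<open>n\<close>: the factor that grows with \<open>n\<close> is
    replaced by the bound on its integral over the box.\<close>
  define C where "C = ennreal (M' / y0 * (8 / r)) * emeasure lborel R + ennreal (M' / y0 * (2 * L)) * ennreal ((2 * r + 2 * r) / m)"
  have "emeasure lborel R < \<infinity>" using \<open>compact R\<close> by (rule emeasure_compact_finite)
  then have C: "C < \<infinity>" by (simp add: C_def ennreal_mult_less_top)
  have "R \<in> sets borel" using \<open>compact R\<close> by (simp add: borel_compact)
  have intR: "(\<integral>\<^sup>+p. indicator R p * ennreal (N n * smooth_step' (- N n * \<rho> p - 1)) \<partial>lborel) \<le> ennreal ((2 * r + 2 * r) / m)" for n
    using nn_integral_smooth_step_box[OF U(2,1) RU _ _ \<sigma> m less_imp_le[OF N[of n]] sel] r(1) unfolding R_def by simp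
  have int_h: "(\<integral>\<^sup>+p. indicator S p * ennreal (h n p) \<partial>lborel) \<le> C" for n
  proof -
    have "continuous_on R (\<lambda>p. N n * smooth_step' (- N n * \<rho> p - 1))"
      by (intro continuous_intros cont\<rho> continuous_on_compose2[OF continuous_on_smooth_step'[of UNIV]]) auto
    then have "(\<lambda>p. indicator R p *\<^sub>R (N n * smooth_step' (- N n * \<rho> p - 1))) \<in> borel_measurable borel"
      using \<open>R \<in> sets borel\<close> by (intro borel_measurable_continuous_on_indicator)
    then have "(\<lambda>p. ennreal (indicator R p *\<^sub>R (N n * smooth_step' (- N n * \<rho> p - 1)))) \<in> borel_measurable borel"
      by measurable
    also have "(\<lambda>p. ennreal (indicator R p *\<^sub>R (N n * smooth_step' (- N n * \<rho> p - 1))))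
        = (\<lambda>p. indicator R p * ennreal (N n * smooth_step' (- N n * \<rho> p - 1)))"
      by (auto simp: indicator_def)
    finally have meas: "(\<lambda>p. indicator R p * ennreal (N n * smooth_step' (- N n * \<rho> p - 1))) \<in> borel_measurable lborel"
      by simp
    have pos: "0 \<le> M' / y0 * (8 / r)" "0 \<le> M' / y0 * (2 * L)" "\<And>p. 0 \<le> N n * smooth_step' (- N n * \<rho> p - 1)"
      using M' y0 r(1) \<open>L \<ge> 0\<close> N[of n] smooth_step'_nonneg by auto
    have "(\<integral>\<^sup>+p. indicator S p * ennreal (h n p) \<partial>lborel)
       \<le> (\<integral>\<^sup>+p. ennreal (M' / y0 * (8 / r)) * indicator R p
           + ennreal (M' / y0 * (2 * L)) * (indicator R p * ennreal (N n * smooth_step' (- N n * \<rho> p - 1))) \<partial>lborel)"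
    proof (rule nn_integral_mono)
      fix p
      have "ennreal (h n p) = ennreal (M' / y0 * (8 / r)) * indicator R p
           + ennreal (M' / y0 * (2 * L)) * (indicator R p * ennreal (N n * smooth_step' (- N n * \<rho> p - 1)))"
      proof -
        have "ennreal (indicator R p * A + B * (indicator R p * v))
            = ennreal A * indicator R p + ennreal B * (indicator R p * ennreal v)"
          if "0 \<le> A" "0 \<le> B" "0 \<le> v" for A B v :: real
          using that by (simp add: indicator_def ennreal_mult)
        from this[OF pos(1,2) pos(3)] show ?thesis unfolding h_def .
      qed
      then show "indicator S p * ennreal (h n p) \<le> ennreal (M' / y0 * (8 / r)) * indicator R p
           + ennreal (M' / y0 * (2 * L)) * (indicator R p * ennreal (N n * smooth_step' (- N n * \<rho> p - 1)))"
        by (simp add: indicator_def)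
    qed
    also have "\<dots> = ennreal (M' / y0 * (8 / r)) * emeasure lborel R
      + ennreal (M' / y0 * (2 * L)) * (\<integral>\<^sup>+p. indicator R p * ennreal (N n * smooth_step' (- N n * \<rho> p - 1)) \<partial>lborel)"
      using meas \<open>R \<in> sets borel\<close> by (simp add: nn_integral_add nn_integral_cmult)
    also have "\<dots> \<le> C"
      unfolding C_def by (intro add_mono mult_left_mono intR) auto
    finally show ?thesis .
  qed
  have nonneg: "0 \<le> \<eta> n p * (P p * Dx f p + Q p * Dy f p)" for n p
    using \<eta>_nonneg g_nonneg unfolding g_def by simp
  have meas_test: "(\<lambda>p. ennreal (indicator S p * (\<eta> n p * g p))) \<in> borel_measurable lborel"
    and int_test: "(\<integral>\<^sup>+p. ennreal (indicator S p * (\<eta> n p * g p)) \<partial>lborel) \<le> C" for n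
  proof -
    note test = nn_integral_test_function_bound[OF PQ div fS(2) \<eta> S(1) K nonneg h, of n]
    show "(\<lambda>p. ennreal (indicator S p * (\<eta> n p * g p))) \<in> borel_measurable lborel"
      unfolding g_def by (rule measurable_compose[OF test(1) measurable_ennreal])
    show "(\<integral>\<^sup>+p. ennreal (indicator S p * (\<eta> n p * g p)) \<partial>lborel) \<le> C"
      unfolding g_def by (rule order_trans[OF test(2) int_h])
  qed
  \<comment> \<open>Phrased with \<open>liminf\<close> to fit Fatou's lemma. In \<open>S\<close> the
    argument of the step tends to infinity because \<open>\<rho> p\<close> is negative.\<close>
  have lim: "liminf (\<lambda>n. ennreal (indicator S p * (\<eta> n p * g p))) = indicator S p * ennreal (box_bump c r p * g p)" for p
  proof (cases "p \<in> S")
    case True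
    then have "\<rho> p < 0" using U(3) by (auto simp: S_def)
    then have "filterlim (\<lambda>n. - N n * \<rho> p - 1) at_top sequentially" unfolding N_def by real_asymp
    from filterlim_compose[OF smooth_step_tendsto_1 this]
    have "(\<lambda>n. \<kappa> n p) \<longlonglongrightarrow> 1" by (simp add: \<kappa>_def)
    then have "(\<lambda>n. ennreal (indicator S p * (\<eta> n p * g p))) \<longlonglongrightarrow> ennreal (indicator S p * (box_bump c r p * 1 * g p))"
      unfolding \<eta>_def by (intro tendsto_intros tendsto_ennrealI)
    then show ?thesis using lim_imp_Liminf[of sequentially] True by simp
  qed (simp add: Liminf_const)
  have "(\<integral>\<^sup>+p. indicator S p * ennreal (box_bump c r p * g p) \<partial>lborel)
      \<le> liminf (\<lambda>n. \<integral>\<^sup>+p. ennreal (indicator S p * (\<eta> n p * g p)) \<partial>lborel)"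
    unfolding lim[symmetric] by (rule nn_integral_liminf[OF meas_test])
  also have "\<dots> \<le> limsup (\<lambda>n. \<integral>\<^sup>+p. ennreal (indicator S p * (\<eta> n p * g p)) \<partial>lborel)"
    by (rule Liminf_le_Limsup) simp
  also have "\<dots> \<le> C"
    by (rule Limsup_bounded) (use int_test in auto)
  finally have fin: "(\<integral>\<^sup>+p. indicator S p * ennreal (box_bump c r p * g p) \<partial>lborel) \<le> C" .
  have VR: "V \<subseteq> R" using r(1) by (auto simp: V_def R_def)
  have "continuous_on S (\<lambda>p. box_bump c r p * g p)"
    using PQ fS(2) bumpS C1_on_imp_continuous_on[OF _ S(1)] unfolding g_def C1_on_def by (intro continuous_intros) blast+
  then have "(\<lambda>p. indicator S p *\<^sub>R (box_bump c r p * g p)) \<in> borel_measurable borel"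
    using S(1) by (intro borel_measurable_continuous_on_indicator) auto
  then have "(\<lambda>p. ennreal (indicator S p *\<^sub>R (box_bump c r p * g p))) \<in> borel_measurable borel"
    by measurable
  also have "(\<lambda>p. ennreal (indicator S p *\<^sub>R (box_bump c r p * g p))) = (\<lambda>p. indicator S p * ennreal (box_bump c r p * g p))"
    by (auto simp: indicator_def)
  finally have meas: "(\<lambda>p. indicator S p * ennreal (box_bump c r p * g p)) \<in> borel_measurable lborel" by simp
  have "(\<integral>\<^sup>+p. indicator (\<Omega> \<inter> V) p * ennreal (area_density f p) \<partial>lborel)
     \<le> (\<integral>\<^sup>+p. ennreal (1 / y0\<^sup>2) * indicator R p + ennreal 4 * (indicator S p * ennreal (box_bump c r p * g p)) \<partial>lborel)"
  proof (rule nn_integral_mono)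
    fix p
    show "indicator (\<Omega> \<inter> V) p * ennreal (area_density f p)
       \<le> ennreal (1 / y0\<^sup>2) * indicator R p + ennreal 4 * (indicator S p * ennreal (box_bump c r p * g p))"
    proof (cases "p \<in> \<Omega> \<inter> V")
      case True
      then have p: "p \<in> R" "p \<in> S" using VR \<open>R \<subseteq> U\<close> by (auto simp: S_def)
      have yp: "snd p > 0" "y0 \<le> snd p" using R_y[OF p(1)] y0 by auto
      have "area_density f p \<le> 1 / (snd p)\<^sup>2 + g p"
        unfolding g_def P_def Q_def by (rule area_density_le_flux_gradient[OF yp(1)])
      also have "1 / (snd p)\<^sup>2 \<le> 1 / y0\<^sup>2" using yp y0 by (intro divide_left_mono power_mono) auto
      also have "g p \<le> 4 * (box_bump c r p * g p)"
        using mult_right_mono[OF box_bump_ge_quarter[OF r(1), of p c] g_nonneg[of p]] True by (simp add: V_def)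
      finally have "ennreal (area_density f p) \<le> ennreal (1 / y0\<^sup>2 + 4 * (box_bump c r p * g p))"
        by (intro ennreal_leI) simp
      also have "\<dots> = ennreal (1 / y0\<^sup>2) + ennreal 4 * ennreal (box_bump c r p * g p)"
        using box_bump_nonneg[of c r p] g_nonneg[of p] by (subst ennreal_plus) (auto simp: ennreal_mult)
      finally show ?thesis using True p by simp
    qed simp
  qed
  also have "\<dots> = ennreal (1 / y0\<^sup>2) * emeasure lborel R
     + ennreal 4 * (\<integral>\<^sup>+p. indicator S p * ennreal (box_bump c r p * g p) \<partial>lborel)"
    using meas \<open>R \<in> sets borel\<close> by (simp add: nn_integral_add nn_integral_cmult)
  also have "\<dots> < \<infinity>"
    using \<open>emeasure lborel R < \<infinity>\<close> le_less_trans[OF fin C] by (simp add: ennreal_mult_less_top)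
  finally have "(\<integral>\<^sup>+p. indicator (\<Omega> \<inter> V) p * ennreal (area_density f p) \<partial>lborel) < \<infinity>" .
  moreover have "open V" "c \<in> V" using r(1) by (auto simp: V_def open_Times mem_Times_iff)
  ultimately show ?thesis by blast
qed

lemma continuous_on_area_density:
  assumes "C1_on S f" "S \<subseteq> half_plane"
  shows "continuous_on S (area_density f)"
  using assms unfolding area_density_def[abs_def] slope_factor_def[abs_def] C1_on_def half_plane_def
  by (auto intro!: continuous_intros)

lemma finite_area_near_interior:
  assumes "open \<Omega>" "\<Omega> \<subseteq> half_plane" "C1_on \<Omega> f" "c \<in> \<Omega>"
  shows "\<exists>V. open V \<and> c \<in> V \<and> (\<integral>\<^sup>+p. indicator (\<Omega> \<inter> V) p * ennreal (area_density f p) \<partial>lborel) < \<infinity>"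
proof -
  obtain e where e: "e > 0" "cball c e \<subseteq> \<Omega>" using assms(1,4) open_contains_cball by blast
  have "continuous_on (cball c e) (area_density f)"
    using continuous_on_area_density[OF assms(3,2)] e(2) by (rule continuous_on_subset)
  then have int: "integrable lborel (\<lambda>p. indicator (cball c e) p *\<^sub>R area_density f p)"
    by (intro borel_integrable_compact) auto
  have "(\<integral>\<^sup>+p. indicator (\<Omega> \<inter> ball c e) p * ennreal (area_density f p) \<partial>lborel)
      \<le> (\<integral>\<^sup>+p. ennreal (norm (indicator (cball c e) p *\<^sub>R area_density f p)) \<partial>lborel)"
    by (rule nn_integral_mono) (auto simp: indicator_def area_density_nonneg)
  also have "\<dots> < \<infinity>" using int by (simp add: integrable_iff_bounded)
  finally show ?thesis using e(1) by (intro exI[of _ "ball c e"]) auto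
qed

text \<open>Finiteness is local on the compact closure: inside, the density is continuous on a
  closed ball; at the boundary the flux estimate applies; finitely many such neighbourhoods cover.
  The sup bound on \<open>f\<close> that the flux estimate needs comes from the extension
  \<open>F\<close>.\<close>

lemma minimal_graph_finite_area:
  assumes \<Omega>: "open \<Omega>" "compact (closure \<Omega>)" "closure \<Omega> \<subseteq> half_plane" "C1_boundary \<Omega>"
    and f: "C2_on \<Omega> f" "minimal_surface_equation \<Omega> f" and F: "continuous_extension \<Omega> f F"
  shows "(\<integral>\<^sup>+p. indicator \<Omega> p * ennreal (area_density f p) \<partial>lborel) < \<infinity>"
proof -
  have "bounded (F ` closure \<Omega>)"
    using F \<Omega>(2) unfolding continuous_extension_def by (blast intro: compact_continuous_image compact_imp_bounded)
  then obtain M where "\<And>z. z \<in> F ` closure \<Omega> \<Longrightarrow> norm z \<le> M" unfolding bounded_iff by blast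
  moreover have "F p = f p" "p \<in> closure \<Omega>" if "p \<in> \<Omega>" for p
    using F that closure_subset unfolding continuous_extension_def by blast+
  ultimately have M: "\<bar>f p\<bar> \<le> M" if "p \<in> \<Omega>" for p using that by (metis image_eqI real_norm_def)
  have sub: "\<Omega> \<subseteq> half_plane" using \<Omega>(3) closure_subset by blast
  have C1: "C1_on \<Omega> f" using f(1) by (simp add: C2_on_def)
  have "\<exists>V. open V \<and> c \<in> V \<and> (\<integral>\<^sup>+p. indicator (\<Omega> \<inter> V) p * ennreal (area_density f p) \<partial>lborel) < \<infinity>"
    if c: "c \<in> closure \<Omega>" for c
  proof (cases "c \<in> \<Omega>")
    case True
    then show ?thesis by (rule finite_area_near_interior[OF \<Omega>(1) sub C1])
  next
    case False
    then have "c \<in> frontier \<Omega>" using c \<Omega>(1) by (simp add: frontier_def interior_open)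
    moreover have "snd c > 0" using c \<Omega>(3) by (auto simp: half_plane_def)
    ultimately show ?thesis using finite_area_near_boundary[OF \<Omega>(1,4) _ _ f M] by blast
  qed
  then obtain V where V: "\<And>c. c \<in> closure \<Omega> \<Longrightarrow> open (V c) \<and> c \<in> V c
      \<and> (\<integral>\<^sup>+p. indicator (\<Omega> \<inter> V c) p * ennreal (area_density f p) \<partial>lborel) < \<infinity>" by metis
  have "closure \<Omega> \<subseteq> (\<Union>c\<in>closure \<Omega>. V c)" using V by blast
  then obtain D where D: "D \<subseteq> closure \<Omega>" "finite D" "closure \<Omega> \<subseteq> (\<Union>c\<in>D. V c)"
    using compactE_image[OF \<Omega>(2), of "closure \<Omega>" V] V by metis
  have meas: "(\<lambda>p. indicator (\<Omega> \<inter> V c) p * ennreal (area_density f p)) \<in> borel_measurable lborel" if "c \<in> D" for c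
  proof -
    have o: "open (\<Omega> \<inter> V c)" using V D(1) that \<Omega>(1) by (blast intro: open_Int)
    have "continuous_on (\<Omega> \<inter> V c) (area_density f)"
      using continuous_on_area_density[OF C1 sub] by (rule continuous_on_subset) simp
    then have "(\<lambda>p. ennreal (indicator (\<Omega> \<inter> V c) p *\<^sub>R area_density f p)) \<in> borel_measurable borel"
      using o by (intro measurable_compose[OF borel_measurable_continuous_on_indicator measurable_ennreal]) auto
    also have "(\<lambda>p. ennreal (indicator (\<Omega> \<inter> V c) p *\<^sub>R area_density f p)) = (\<lambda>p. indicator (\<Omega> \<inter> V c) p * ennreal (area_density f p))"
      by (auto simp: indicator_def)
    finally show ?thesis by simp
  qed
  have "(\<integral>\<^sup>+p. indicator \<Omega> p * ennreal (area_density f p) \<partial>lborel)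
     \<le> (\<integral>\<^sup>+p. (\<Sum>c\<in>D. indicator (\<Omega> \<inter> V c) p * ennreal (area_density f p)) \<partial>lborel)"
  proof (rule nn_integral_mono)
    fix p
    show "indicator \<Omega> p * ennreal (area_density f p) \<le> (\<Sum>c\<in>D. indicator (\<Omega> \<inter> V c) p * ennreal (area_density f p))"
    proof (cases "p \<in> \<Omega>")
      case True
      then obtain c where c: "c \<in> D" "p \<in> V c" using D(3) closure_subset by blast
      have "indicator \<Omega> p * ennreal (area_density f p) = indicator (\<Omega> \<inter> V c) p * ennreal (area_density f p)"
        using True c by simp
      also have "\<dots> \<le> (\<Sum>c\<in>D. indicator (\<Omega> \<inter> V c) p * ennreal (area_density f p))"
        by (rule member_le_sum[OF c(1)]) (use D(2) in auto)
      finally show ?thesis .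
    qed simp
  qed
  also have "\<dots> = (\<Sum>c\<in>D. \<integral>\<^sup>+p. indicator (\<Omega> \<inter> V c) p * ennreal (area_density f p) \<partial>lborel)"
    by (rule nn_integral_sum[OF meas])
  also have "\<dots> < \<infinity>" using V D(1) by (auto simp: ennreal_sum_less_top[OF D(2)])
  finally show ?thesis .
qed

section \<open>Comparison of areas\<close>

text \<open>Each point of \<open>A\<close> owns an open gap of \<open>A\<close> to its right. The
  gaps are disjoint, so a rational chosen in each labels the points injectively.\<close>

lemma countable_right_isolated:
  fixes A :: "real set"
  assumes "\<And>x. x \<in> A \<Longrightarrow> \<exists>e>0. \<forall>t. x < t \<and> t < x + e \<longrightarrow> t \<notin> A"
  shows "countable A"
proof -
  obtain e where e: "\<And>x. x \<in> A \<Longrightarrow> e x > 0" "\<And>x t. x \<in> A \<Longrightarrow> x < t \<Longrightarrow> t < x + e x \<Longrightarrow> t \<notin> A"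
    using assms by metis
  have "\<exists>q::rat. x < of_rat q \<and> of_rat q < x + e x" if "x \<in> A" for x
    using e(1)[OF that] of_rat_dense[of x "x + e x"] by auto
  then obtain q :: "real \<Rightarrow> rat" where q: "\<And>x. x \<in> A \<Longrightarrow> x < of_rat (q x)" "\<And>x. x \<in> A \<Longrightarrow> of_rat (q x) < x + e x"
    by metis
  have "inj_on q A"
  proof (rule inj_onI)
    fix x x' assume x: "x \<in> A" "x' \<in> A" "q x = q x'"
    show "x = x'"
    proof (rule ccontr)
      assume "x \<noteq> x'"
      then consider "x < x'" | "x' < x" by linarith
      then show False
        using x q[OF x(1)] q[OF x(2)] e(2)[OF x(1), of x'] e(2)[OF x(2), of x] by cases auto
    qed
  qed
  then show ?thesis by (rule countableI')
qed

text \<open>Near such a zero the difference quotient is close to the non-zero derivative, so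
  \<open>u\<close> has no other zero there.\<close>

lemma countable_simple_zeros:
  fixes u u' :: "real \<Rightarrow> real"
  assumes "\<And>x. x \<in> A \<Longrightarrow> (u has_real_derivative u' x) (at x) \<and> u' x \<noteq> 0 \<and> u x = 0"
  shows "countable A"
proof (rule countable_right_isolated)
  fix x assume x: "x \<in> A"
  have "((\<lambda>t. (u t - u x) / (t - x)) \<longlongrightarrow> u' x) (at x)"
    using assms[OF x] unfolding has_field_derivative_iff by blast
  then have "\<forall>\<^sub>F t in at x. (u t - u x) / (t - x) \<noteq> 0"
    using assms[OF x] by (intro tendsto_imp_eventually_ne) auto
  then obtain e where "e > 0" "\<And>t. t \<noteq> x \<Longrightarrow> dist t x < e \<Longrightarrow> (u t - u x) / (t - x) \<noteq> 0"
    unfolding eventually_at by blast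
  then have "t \<notin> A" if "x < t" "t < x + e" for t
    using that assms[OF x] assms[of t] by (force simp: dist_real_def)
  then show "\<exists>e>0. \<forall>t. x < t \<and> t < x + e \<longrightarrow> t \<notin> A" using \<open>e > 0\<close> by blast
qed

text \<open>On each axis-parallel line, the zeros of \<open>w\<close> with non-zero derivative along the line are isolated.\<close>

lemma AE_gradient_eq_0:
  assumes w: "C1_on S w" and S: "open S"
  shows "AE p in lborel. p \<in> S \<longrightarrow> w p = 0 \<longrightarrow> Dx w p = 0 \<and> Dy w p = 0"
proof -
  have meas: "(\<lambda>p. indicator S p *\<^sub>R w p) \<in> borel_measurable borel"
    "(\<lambda>p. indicator S p *\<^sub>R Dx w p) \<in> borel_measurable borel" "(\<lambda>p. indicator S p *\<^sub>R Dy w p) \<in> borel_measurable borel"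
    using w C1_on_imp_continuous_on[OF w S] S unfolding C1_on_def
    by (intro borel_measurable_continuous_on_indicator; auto)+
  \<comment> \<open>\<open>w\<close> and its partials are continuous on \<open>S\<close> only; the
    indicator factors make them Borel functions on the plane and change nothing on
    \<open>S\<close>.\<close>
  define N where "N = (\<lambda>v::real\<times>real\<Rightarrow>real. {p \<in> S. indicator S p *\<^sub>R w p = 0 \<and> indicator S p *\<^sub>R v p \<noteq> 0})"
  have N: "N (Dx w) \<in> sets borel" "N (Dy w) \<in> sets borel"
  proof -
    note [measurable] = meas borel_open[OF S]
    show "N (Dx w) \<in> sets borel" "N (Dy w) \<in> sets borel" unfolding N_def by measurable
  qed
  then have ind: "(indicator (N (Dx w)) :: _ \<Rightarrow> ennreal) \<in> borel_measurable (lborel \<Otimes>\<^sub>M lborel)"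
    "(indicator (N (Dy w)) :: _ \<Rightarrow> ennreal) \<in> borel_measurable (lborel \<Otimes>\<^sub>M lborel)"
    by (simp_all add: lborel_prod)
  have cx: "countable {x. (x, y) \<in> N (Dx w)}" for y
    by (rule countable_simple_zeros[of _ "\<lambda>x. w (x, y)" "\<lambda>x. Dx w (x, y)"])
       (auto simp: N_def C1_on_DERIV(1)[OF w])
  have cy: "countable {y. (x, y) \<in> N (Dy w)}" for x
    by (rule countable_simple_zeros[of _ "\<lambda>y. w (x, y)" "\<lambda>y. Dy w (x, y)"])
       (auto simp: N_def C1_on_DERIV(2)[OF w])
  have null: "(\<integral>\<^sup>+x. indicator A x \<partial>lborel) = (0::ennreal)" if "countable A" for A :: "real set"
    using countable_imp_null_set_lborel[OF that] by (simp add: null_sets_def)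
  have "emeasure lborel (N (Dx w)) = (\<integral>\<^sup>+y. (\<integral>\<^sup>+x. indicator (N (Dx w)) (x, y) \<partial>lborel) \<partial>lborel)"
    using lborel_pair.nn_integral_snd[OF ind(1)] N(1) by (simp add: lborel_prod)
  also have "\<dots> = (\<integral>\<^sup>+y. (\<integral>\<^sup>+x. indicator {x. (x, y) \<in> N (Dx w)} x \<partial>lborel) \<partial>lborel)"
    by (simp add: indicator_def of_bool_def)
  also have "\<dots> = 0" by (simp only: null[OF cx]) simp
  finally have x: "N (Dx w) \<in> null_sets lborel" using N(1) by (simp add: null_sets_def)
  have "emeasure lborel (N (Dy w)) = (\<integral>\<^sup>+x. (\<integral>\<^sup>+y. indicator (N (Dy w)) (x, y) \<partial>lborel) \<partial>lborel)"
    using lborel.nn_integral_fst[OF ind(2)] N(2) by (simp add: lborel_prod)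
  also have "\<dots> = (\<integral>\<^sup>+x. (\<integral>\<^sup>+y. indicator {y. (x, y) \<in> N (Dy w)} y \<partial>lborel) \<partial>lborel)"
    by (simp add: indicator_def of_bool_def)
  also have "\<dots> = 0" by (simp only: null[OF cy]) simp
  finally have y: "N (Dy w) \<in> null_sets lborel" using N(2) by (simp add: null_sets_def)
  show ?thesis using AE_not_in[OF x] AE_not_in[OF y]
    by eventually_elim (auto simp: N_def)
qed

text \<open>For non-zero n this is 1/n times a fixed odd function of n t. Its derivative therefore
  depends on n t alone and is bounded independently of \<open>n\<close>; oddness treats both signs
  of the truncated function alike.\<close>

definition truncate :: "real \<Rightarrow> real \<Rightarrow> real" where
  "truncate n t = t * smooth_step (n\<^sup>2 * t\<^sup>2 - 1)"

definition truncate' :: "real \<Rightarrow> real \<Rightarrow> real" where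
  "truncate' n t = smooth_step (n\<^sup>2 * t\<^sup>2 - 1) + 2 * (n\<^sup>2 * t\<^sup>2) * smooth_step' (n\<^sup>2 * t\<^sup>2 - 1)"

lemma DERIV_truncate: "(truncate n has_real_derivative truncate' n t) (at t)"
proof -
  have "((\<lambda>t. n\<^sup>2 * t\<^sup>2 - 1) has_real_derivative 2 * n\<^sup>2 * t) (at t)" by (auto intro!: derivative_eq_intros)
  from DERIV_mult[OF DERIV_ident DERIV_chain2[OF DERIV_smooth_step this]]
  have "((\<lambda>t. t * smooth_step (n\<^sup>2 * t\<^sup>2 - 1)) has_real_derivative
      1 * smooth_step (n\<^sup>2 * t\<^sup>2 - 1) + smooth_step' (n\<^sup>2 * t\<^sup>2 - 1) * (2 * n\<^sup>2 * t) * t) (at t)" .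
  then show ?thesis
    by (simp add: truncate_def[abs_def] truncate'_def power2_eq_square mult_ac)
qed

lemma continuous_on_truncate': "continuous_on A (truncate' n)"
proof -
  have "continuous_on UNIV smooth_step"
    by (meson DERIV_smooth_step DERIV_isCont continuous_at_imp_continuous_on)
  moreover have "continuous_on A (\<lambda>t. n\<^sup>2 * t\<^sup>2 - 1)" by (intro continuous_intros)
  ultimately have "continuous_on A (\<lambda>t. smooth_step (n\<^sup>2 * t\<^sup>2 - 1))"
      "continuous_on A (\<lambda>t. smooth_step' (n\<^sup>2 * t\<^sup>2 - 1))"
    using continuous_on_compose2[OF _ _ subset_UNIV] continuous_on_smooth_step' by metis+
  then show ?thesis unfolding truncate'_def[abs_def] by (intro continuous_intros)
qed

lemma truncate_eq_0: "n\<^sup>2 * t\<^sup>2 \<le> 1 \<Longrightarrow> truncate n t = 0"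
  by (simp add: truncate_def smooth_step_eq_0)

text \<open>With s = n^2 t^2 - 1 the second summand of \<open>truncate'\<close> is
  \<open>2 * (s + 1) * smooth_step' s\<close>, for positive s equal to 4 s (s + 1) / (1 + s^2)^2.
  This is at most 4, by completing a square, and the step is at most 1.\<close>

lemma abs_truncate'_le: "\<bar>truncate' n t\<bar> \<le> 5"
proof -
  define s where "s = n\<^sup>2 * t\<^sup>2 - 1"
  have "0 \<le> 2 * (s + 1) * smooth_step' s \<and> 2 * (s + 1) * smooth_step' s \<le> 4"
  proof (cases "s \<le> 0")
    case False
    have "(1 + s\<^sup>2)\<^sup>2 - s * (s + 1) = (s\<^sup>2)\<^sup>2 + (s - 1/2)\<^sup>2 + 3/4"
      by (simp add: power2_eq_square algebra_simps)
    also have "\<dots> \<ge> 0" by (intro add_nonneg_nonneg) auto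
    finally have "s * (s + 1) \<le> (1 + s\<^sup>2)\<^sup>2" by simp
    then have "s * (s + 1) / (1 + s\<^sup>2)\<^sup>2 \<le> 1" by (simp add: divide_le_eq_1 one_plus_square_neq_0)
    moreover have "2 * (s + 1) * smooth_step' s = 4 * (s * (s + 1) / (1 + s\<^sup>2)\<^sup>2)"
      using False by (simp add: smooth_step'_def)
    ultimately show ?thesis using False by simp
  qed (simp add: smooth_step'_eq_0)
  then show ?thesis
    using smooth_step_nonneg[of s] smooth_step_le_1[of s] by (simp add: truncate'_def s_def)
qed

text \<open>Both summands are functions of s = n^2 t^2 - 1, which tends to infinity; the step tends
  to 1 and the other summand decays like 4/s^2.\<close>

lemma truncate'_tendsto_1:
  assumes "t \<noteq> 0"
  shows "(\<lambda>n. truncate' (real (Suc n)) t) \<longlonglongrightarrow> 1"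
proof -
  have "((\<lambda>s::real. 2 * (s + 1) * (2 * s / (1 + s\<^sup>2)\<^sup>2)) \<longlongrightarrow> 0) at_top" by real_asymp
  moreover have "\<forall>\<^sub>F s::real in at_top. 2 * (s + 1) * (2 * s / (1 + s\<^sup>2)\<^sup>2) = 2 * (s + 1) * smooth_step' s"
    using eventually_ge_at_top[of "0::real"] by eventually_elim (simp add: smooth_step'_def)
  ultimately have "((\<lambda>s. 2 * (s + 1) * smooth_step' s) \<longlongrightarrow> 0) at_top"
    by (rule Lim_transform_eventually)
  from tendsto_add[OF smooth_step_tendsto_1 this]
  have lim: "((\<lambda>s. smooth_step s + 2 * (s + 1) * smooth_step' s) \<longlongrightarrow> 1) at_top" by simp
  have "t\<^sup>2 > 0" using assms by simp
  then have "filterlim (\<lambda>n. (real (Suc n))\<^sup>2 * t\<^sup>2 - 1) at_top sequentially" by real_asymp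
  from filterlim_compose[OF lim this] show ?thesis by (simp add: truncate'_def)
qed

text \<open>The gradient of the truncated \<open>w\<close> is \<open>truncate' n (w p)\<close> times
  that of \<open>w\<close>, so the integrand times this factor integrates to 0 for every
  \<open>n\<close>. Dominated convergence, with 5 times the absolute value of the integrand as
  majorant, removes the factor.\<close>

lemma integral_flux_gradient_eq_0:
  assumes \<Omega>: "open \<Omega>" "compact (closure \<Omega>)"
    and P: "C1_on \<Omega> P" and Q: "C1_on \<Omega> Q" and div: "\<And>p. p \<in> \<Omega> \<Longrightarrow> Dx P p + Dy Q p = 0"
    and w: "C1_on \<Omega> w" and W: "continuous_extension \<Omega> w W" and W0: "\<And>p. p \<in> frontier \<Omega> \<Longrightarrow> W p = 0"
    and int: "integrable lborel (\<lambda>p. indicator \<Omega> p * (P p * Dx w p + Q p * Dy w p))"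
  shows "(\<integral>p. indicator \<Omega> p * (P p * Dx w p + Q p * Dy w p) \<partial>lborel) = 0"
proof -
  define T where "T = (\<lambda>p. indicator \<Omega> p * (P p * Dx w p + Q p * Dy w p))"
  \<comment> \<open>A closed condition on the compact closure; the set misses the frontier, where
    \<open>W\<close> is 0.\<close>
  define K where "K = (\<lambda>n. {p \<in> closure \<Omega>. 1 \<le> (real (Suc n))\<^sup>2 * (W p)\<^sup>2})"
  have contW: "continuous_on (closure \<Omega>) W" and Ww: "\<And>p. p \<in> \<Omega> \<Longrightarrow> W p = w p"
    using W by (auto simp: continuous_extension_def)
  have K: "compact (K n)" "K n \<subseteq> \<Omega>" for n
  proof -
    have "closed (closure \<Omega> \<inter> (\<lambda>p. (real (Suc n))\<^sup>2 * (W p)\<^sup>2) -` {1..})"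
      by (intro continuous_closed_preimage continuous_intros contW) auto
    from compact_Int_closed[OF \<Omega>(2) this] show "compact (K n)"
      by (simp add: K_def Int_def vimage_def)
    show "K n \<subseteq> \<Omega>"
    proof
      fix p assume p: "p \<in> K n"
      then have "W p \<noteq> 0" by (auto simp: K_def)
      then have "p \<notin> frontier \<Omega>" using W0 by blast
      then show "p \<in> \<Omega>" using p \<Omega>(1) by (simp add: K_def frontier_def interior_open)
    qed
  qed
  have vanish: "truncate (real (Suc n)) (w p) = 0" if "p \<in> \<Omega> - K n" for n p
  proof (rule truncate_eq_0)
    have "p \<in> closure \<Omega>" using that closure_subset by blast
    then show "(real (Suc n))\<^sup>2 * (w p)\<^sup>2 \<le> 1" using that Ww[of p] by (auto simp: K_def)
  qed
  note comp = C1_on_comp[OF w \<Omega>(1) DERIV_truncate continuous_on_truncate']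
    Dx_comp[OF w \<Omega>(1) DERIV_truncate continuous_on_truncate']
    Dy_comp[OF w \<Omega>(1) DERIV_truncate continuous_on_truncate']
  have eq: "indicator \<Omega> p * (P p * Dx (\<lambda>p. truncate n (w p)) p + Q p * Dy (\<lambda>p. truncate n (w p)) p)
      = truncate' n (w p) * T p" for n p
    by (cases "p \<in> \<Omega>") (simp_all add: comp T_def algebra_simps)
  have int_n: "integrable lborel (\<lambda>p. truncate' (real (Suc n)) (w p) * T p)"
    and int_n_0: "(\<integral>p. truncate' (real (Suc n)) (w p) * T p \<partial>lborel) = 0" for n
    using integral_divergence_free[OF P Q div comp(1) \<Omega>(1) K vanish, of n n] unfolding eq by simp_all
  have "(\<lambda>n. \<integral>p. truncate' (real (Suc n)) (w p) * T p \<partial>lborel) \<longlonglongrightarrow> (\<integral>p. T p \<partial>lborel)"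
  proof (rule integral_dominated_convergence[where w="\<lambda>p. 5 * \<bar>T p\<bar>"])
    show "T \<in> borel_measurable lborel" using int unfolding T_def by (rule borel_measurable_integrable)
    show "(\<lambda>p. truncate' (real (Suc n)) (w p) * T p) \<in> borel_measurable lborel" for n
      by (rule borel_measurable_integrable[OF int_n])
    show "integrable lborel (\<lambda>p. 5 * \<bar>T p\<bar>)" using int unfolding T_def by simp
    show "AE p in lborel. norm (truncate' (real (Suc n)) (w p) * T p) \<le> 5 * \<bar>T p\<bar>" for n
      by (intro AE_I2) (simp add: abs_mult mult_right_mono abs_truncate'_le del: of_nat_Suc)
    show "AE p in lborel. (\<lambda>n. truncate' (real (Suc n)) (w p) * T p) \<longlonglongrightarrow> T p"
      using AE_gradient_eq_0[OF w \<Omega>(1)]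
    proof eventually_elim
      case (elim p)
      show ?case
      proof (cases "w p = 0")
        case True
        \<comment> \<open>At a zero of \<open>w\<close> the factor \<open>truncate'\<close> is 0 for
          every \<open>n\<close> and does not tend to 1. The limit is still right at almost every
          such point, because the gradient of \<open>w\<close> vanishes there.\<close>
        then have "T p = 0" using elim by (simp add: T_def indicator_def)
        then show ?thesis by simp
      next
        case False
        from tendsto_mult[OF truncate'_tendsto_1[OF this] tendsto_const, of "T p"]
        show ?thesis by simp
      qed
    qed
  qed
  then show ?thesis unfolding int_n_0 by (simp add: LIMSEQ_const_iff T_def)
qed

text \<open>The gap \<open>e\<close> between a convex function of the gradient and its tangent plane
  is, up to the positive denominator y^2 a, equal to a b - d. Here a and b are the lengths of the
  vectors (1, y grad f) and (1, y grad g), and d is their scalar product, so this is the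
  Cauchy-Schwarz inequality. The first coordinates agree, so equality forces the vectors to
  agree.\<close>

lemma area_density_tangent:
  fixes f g :: "real \<times> real \<Rightarrow> real"
  assumes "snd p > 0"
  defines "e \<equiv> area_density g p - area_density f p
     - (Dx f p / slope_factor f p * (Dx g p - Dx f p) + Dy f p / slope_factor f p * (Dy g p - Dy f p))"
  shows "0 \<le> e" and "e = 0 \<Longrightarrow> Dx g p = Dx f p \<and> Dy g p = Dy f p"
proof -
  define a b y where "a = slope_factor f p" and "b = slope_factor g p" and "y = snd p"
  define f1 f2 g1 g2 where "f1 = Dx f p" "f2 = Dy f p" "g1 = Dx g p" "g2 = Dy g p"
  note defs = a_def b_def y_def f1_f2_g1_g2_def
  have pos: "a > 0" "b > 0" "y > 0" using slope_factor_pos assms(1) by (auto simp: defs)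
  have sq: "a\<^sup>2 = 1 + y\<^sup>2 * (f1\<^sup>2 + f2\<^sup>2)" "b\<^sup>2 = 1 + y\<^sup>2 * (g1\<^sup>2 + g2\<^sup>2)"
    by (simp_all add: defs slope_factor_square)
  define d where "d = 1 + y\<^sup>2 * (f1 * g1 + f2 * g2)"
  \<comment> \<open>Lagrange's identity: the summands besides \<open>d\<^sup>2\<close> make up the
    squared length of the cross product.\<close>
  have "(a * b)\<^sup>2 = d\<^sup>2 + y\<^sup>2 * ((g1 - f1)\<^sup>2 + (g2 - f2)\<^sup>2) + (y\<^sup>2 * (f1 * g2 - f2 * g1))\<^sup>2"
    unfolding power_mult_distrib sq d_def by algebra
  then have ge: "d\<^sup>2 + y\<^sup>2 * ((g1 - f1)\<^sup>2 + (g2 - f2)\<^sup>2) \<le> (a * b)\<^sup>2" by simp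
  have "0 \<le> y\<^sup>2 * ((g1 - f1)\<^sup>2 + (g2 - f2)\<^sup>2)" by simp
  then have "d\<^sup>2 \<le> (a * b)\<^sup>2" using ge by linarith
  from power2_le_imp_le[OF this] have dab: "d \<le> a * b" using pos by simp
  have "b / y\<^sup>2 = a * b / (y\<^sup>2 * a)" "a / y\<^sup>2 = a\<^sup>2 / (y\<^sup>2 * a)"
    using pos by (simp_all add: power2_eq_square)
  moreover have "f1 / a * (g1 - f1) + f2 / a * (g2 - f2) = (f1 * (g1 - f1) + f2 * (g2 - f2)) / a"
    by (simp add: add_divide_distrib)
  then have "f1 / a * (g1 - f1) + f2 / a * (g2 - f2) = y\<^sup>2 * (f1 * (g1 - f1) + f2 * (g2 - f2)) / (y\<^sup>2 * a)"
    using pos by simp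
  ultimately have "b / y\<^sup>2 - a / y\<^sup>2 - (f1 / a * (g1 - f1) + f2 / a * (g2 - f2))
     = (a * b - a\<^sup>2 - y\<^sup>2 * (f1 * (g1 - f1) + f2 * (g2 - f2))) / (y\<^sup>2 * a)"
    by (simp only: diff_divide_distrib)
  also have "a * b - a\<^sup>2 - y\<^sup>2 * (f1 * (g1 - f1) + f2 * (g2 - f2)) = a * b - d"
    unfolding sq d_def by algebra
  finally have e: "e = (a * b - d) / (y\<^sup>2 * a)" by (simp add: e_def area_density_def defs)
  show "0 \<le> e" unfolding e using dab pos by simp
  assume "e = 0"
  then have "a * b = d" using pos by (simp add: e)
  then have "y\<^sup>2 * ((g1 - f1)\<^sup>2 + (g2 - f2)\<^sup>2) \<le> 0" using ge by simp
  then have "(g1 - f1)\<^sup>2 + (g2 - f2)\<^sup>2 \<le> 0" using pos by (simp add: mult_le_0_iff)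
  then show "Dx g p = Dx f p \<and> Dy g p = Dy f p" by (simp add: sum_power2_le_zero_iff defs)
qed

lemma area_H2R_graph_map:
  assumes "\<Omega> \<subseteq> half_plane" "C1_on \<Omega> f"
  shows "area_H2R \<Omega> (graph_map f) = (\<integral>\<^sup>+p. indicator \<Omega> p * ennreal (area_density f p) \<partial>lborel)"
  unfolding area_graph[OF assms]
  by (intro nn_integral_cong) (auto simp: area_density_def slope_factor_def mult.commute split: prod.splits)

text \<open>Functions that agree on \<open>\<Omega>\<close> may differ elsewhere; openness ensures
  that the partials at \<open>p\<close> see nothing outside \<open>\<Omega>\<close>.\<close>

lemma Dx_Dy_cong_open:
  assumes "open \<Omega>" "p \<in> \<Omega>" "\<And>q. q \<in> \<Omega> \<Longrightarrow> f q = g q" "C1_on \<Omega> f"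
  shows "Dx f p = Dx g p" "Dy f p = Dy g p"
proof -
  obtain x y where p: "p = (x, y)" by (cases p)
  have "open ((\<lambda>t. (t, y)) -` \<Omega>)" "open ((\<lambda>t. (x, t)) -` \<Omega>)"
    by (intro open_vimage assms(1) continuous_intros)+
  then have "\<forall>\<^sub>F t in nhds x. g (t, y) = f (t, y)" "\<forall>\<^sub>F t in nhds y. g (x, t) = f (x, t)"
    using assms(2,3) unfolding eventually_nhds p by (metis vimageE vimageI2)+
  then have "((\<lambda>t. g (t, y)) has_real_derivative Dx f p) (at x)" "((\<lambda>t. g (x, t)) has_real_derivative Dy f p) (at y)"
    using C1_on_DERIV[OF assms(4), of x y] assms(2) p by (auto simp: DERIV_cong_ev[OF refl _ refl])
  then show "Dx f p = Dx g p" "Dy f p = Dy g p" using Dx_eqI Dy_eqI p by metis+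
qed

text \<open>The set where \<open>e\<close> is non-zero is open in the space, and a non-empty open
  set is not negligible. This carries equality of areas over to equality of gradients at every
  point.\<close>

lemma continuous_AE_eq_0_open:
  fixes e :: "'a::euclidean_space \<Rightarrow> real"
  assumes "open S" "continuous_on S e" "AE p in lborel. p \<in> S \<longrightarrow> e p = 0" "p \<in> S"
  shows "e p = 0"
proof (rule ccontr)
  assume "e p \<noteq> 0"
  define A where "A = S \<inter> e -` (- {0})"
  have "open A" unfolding A_def by (rule continuous_open_preimage[OF assms(2,1)]) auto
  moreover have "A \<noteq> {}" using assms(4) \<open>e p \<noteq> 0\<close> by (auto simp: A_def)
  moreover have "AE p in lborel. p \<notin> A" using assms(3) by eventually_elim (auto simp: A_def)
  then have "A \<in> null_sets lborel" using \<open>open A\<close> by (simp add: AE_iff_null_sets)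
  then have "negligible A" by (simp add: negligible_iff_null_sets null_sets_completionI)
  ultimately show False using open_not_negligible by blast
qed

theorem theorem2p1:
  fixes \<Omega> :: "(real \<times> real) set" and f g F G :: "real \<times> real \<Rightarrow> real"
  assumes "open \<Omega>" and "connected \<Omega>" and "\<Omega> \<noteq> {}"
    and "compact (closure \<Omega>)" and "closure \<Omega> \<subseteq> half_plane"
    and "C1_boundary \<Omega>"
    and "C2_on \<Omega> f" and "minimal_surface_equation \<Omega> f" and "continuous_extension \<Omega> f F"
    and "C2_on \<Omega> g" and "continuous_extension \<Omega> g G"
    and "\<forall>p\<in>frontier \<Omega>. G p = F p"
  shows "area_H2R \<Omega> (graph_map f) \<le> area_H2R \<Omega> (graph_map g) \<and>
    (area_H2R \<Omega> (graph_map f) = area_H2R \<Omega> (graph_map g) \<longleftrightarrow> (\<forall>p\<in>\<Omega>. f p = g p))"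
proof -
  have sub: "\<Omega> \<subseteq> half_plane" using assms(5) closure_subset by blast
  have y_pos: "snd p > 0" if "p \<in> \<Omega>" for p using sub that by (auto simp: half_plane_def)
  have Cf: "C1_on \<Omega> f" "C1_on \<Omega> (Dx f)" "C1_on \<Omega> (Dy f)" and Cg: "C1_on \<Omega> g"
    using assms(7,10) by (auto simp: C2_on_def)
  note area = area_H2R_graph_map[OF sub Cf(1)] area_H2R_graph_map[OF sub Cg]
  have fin: "area_H2R \<Omega> (graph_map f) < \<infinity>"
    unfolding area by (rule minimal_graph_finite_area[OF assms(1,4,5,6,7,8,9)])
  have same: "area_H2R \<Omega> (graph_map f) = area_H2R \<Omega> (graph_map g)" if eq: "\<forall>p\<in>\<Omega>. f p = g p"
  proof -
    have "area_density f p = area_density g p" if "p \<in> \<Omega>" for p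
      using Dx_Dy_cong_open[OF assms(1) that _ Cf(1), of g] eq by (simp add: area_density_def slope_factor_def)
    then show ?thesis unfolding area by (intro nn_integral_cong) (auto simp: indicator_def)
  qed
  show ?thesis
  proof (cases "area_H2R \<Omega> (graph_map g) < \<infinity>")
    \<comment> \<open>For a competitor of infinite area the inequality is strict by
      \<open>fin\<close>, and by \<open>same\<close> the two functions cannot agree on
      \<open>\<Omega>\<close>.\<close>
    case False
    then have "area_H2R \<Omega> (graph_map g) = \<infinity>" by (simp add: less_top[symmetric])
    then show ?thesis using fin same by auto
  next
    case True
    define P Q where "P = (\<lambda>p. Dx f p / slope_factor f p)" and "Q = (\<lambda>p. Dy f p / slope_factor f p)"
    define w where "w = (\<lambda>p. g p - f p)"
    note w = C1_on_diff[OF Cg Cf(1) assms(1), folded w_def]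
    have Dw: "Dx w p = Dx g p - Dx f p" "Dy w p = Dy g p - Dy f p" if "p \<in> \<Omega>" for p
      unfolding w_def using that by (simp_all add: Dx_diff[OF Cg Cf(1) assms(1)] Dy_diff[OF Cg Cf(1) assms(1)])
    have PQ: "C1_on \<Omega> P" "C1_on \<Omega> Q"
      unfolding P_def Q_def by (intro C1_on_divide_slope_factor assms Cf)+
    have div: "Dx P p + Dy Q p = 0" if "p \<in> \<Omega>" for p
      unfolding P_def Q_def by (rule minimal_surface_flux_divergence_free[OF assms(7,1,8) that])
    let ?T = "\<lambda>p. indicator \<Omega> p * (P p * Dx w p + Q p * Dy w p)"
    let ?I = "\<lambda>h p. indicator \<Omega> p * area_density h p"
    have int: "integrable lborel (?I h)" and I_eq: "area_H2R \<Omega> (graph_map h) = ennreal (integral\<^sup>L lborel (?I h))"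
      if h: "C1_on \<Omega> h" "area_H2R \<Omega> (graph_map h) < \<infinity>" for h
    proof -
      have "(\<lambda>p. indicator \<Omega> p *\<^sub>R area_density h p) \<in> borel_measurable borel"
        using continuous_on_area_density[OF h(1) sub] assms(1) by (intro borel_measurable_continuous_on_indicator) auto
      then have meas: "?I h \<in> borel_measurable lborel" by simp
      have eq: "area_H2R \<Omega> (graph_map h) = (\<integral>\<^sup>+p. ennreal (?I h p) \<partial>lborel)"
        unfolding area_H2R_graph_map[OF sub h(1)] by (intro nn_integral_cong) (auto simp: indicator_def)
      have nonneg: "0 \<le> ?I h p" for p by (simp add: area_density_nonneg)
      show int: "integrable lborel (?I h)"
        using meas h(2) nonneg unfolding eq by (intro integrableI_nonneg) auto
      show "area_H2R \<Omega> (graph_map h) = ennreal (integral\<^sup>L lborel (?I h))"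
        unfolding eq using int nonneg by (intro nn_integral_eq_integral) auto
    qed
    note If = int[OF Cf(1) fin] and Ig = int[OF Cg True]
    have contT: "continuous_on \<Omega> (\<lambda>p. P p * Dx w p + Q p * Dy w p)"
      using PQ w C1_on_imp_continuous_on[OF _ assms(1)] unfolding C1_on_def by (intro continuous_intros) blast+
    \<comment> \<open>A component of the flux is at most 1/y and a partial of \<open>w\<close> at
      most the sum of the two slope factors over y; the product is the sum of the two area
      densities. The factor 2 counts the components.\<close>
    have intT: "integrable lborel ?T"
    proof (rule Bochner_Integration.integrable_bound)
      show "integrable lborel (\<lambda>p. 2 * (?I f p + ?I g p))"
        by (intro integrable_mult_right Bochner_Integration.integrable_add If Ig)
      have "(\<lambda>p. indicator \<Omega> p *\<^sub>R (P p * Dx w p + Q p * Dy w p)) \<in> borel_measurable borel"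
        using contT assms(1) by (intro borel_measurable_continuous_on_indicator) auto
      then show "?T \<in> borel_measurable lborel" by simp
      have bound: "\<bar>P p * Dx w p + Q p * Dy w p\<bar> \<le> 2 * (area_density f p + area_density g p)" if p: "p \<in> \<Omega>" for p
      proof -
        define y where "y = snd p"
        have y: "y > 0" using y_pos[OF p] by (simp add: y_def)
        have "y * \<bar>Dx w p\<bar> \<le> y * (\<bar>Dx g p\<bar> + \<bar>Dx f p\<bar>)" "y * \<bar>Dy w p\<bar> \<le> y * (\<bar>Dy g p\<bar> + \<bar>Dy f p\<bar>)"
          unfolding Dw[OF p] using y by (intro mult_left_mono; simp)+
        then have "y * \<bar>Dx w p\<bar> \<le> slope_factor f p + slope_factor g p"
            "y * \<bar>Dy w p\<bar> \<le> slope_factor f p + slope_factor g p"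
          using abs_mult_le_slope_factor[OF y_pos[OF p], of f] abs_mult_le_slope_factor[OF y_pos[OF p], of g]
          unfolding distrib_left y_def by linarith+
        then have dw: "\<bar>Dx w p\<bar> \<le> (slope_factor f p + slope_factor g p) / y"
            "\<bar>Dy w p\<bar> \<le> (slope_factor f p + slope_factor g p) / y"
          using y by (simp_all add: le_divide_eq mult.commute)
        have flux: "\<bar>P p\<bar> \<le> 1 / y" "\<bar>Q p\<bar> \<le> 1 / y"
          unfolding P_def Q_def y_def by (rule abs_flux_le[OF y_pos[OF p]])+
        have "0 \<le> 1 / y" using y by simp
        then have "\<bar>P p * Dx w p\<bar> \<le> 1 / y * ((slope_factor f p + slope_factor g p) / y)"
            "\<bar>Q p * Dy w p\<bar> \<le> 1 / y * ((slope_factor f p + slope_factor g p) / y)"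
          unfolding abs_mult by (rule mult_mono[OF flux(1) dw(1) _ abs_ge_zero] mult_mono[OF flux(2) dw(2) _ abs_ge_zero])+
        moreover have "1 / y * ((slope_factor f p + slope_factor g p) / y) = area_density f p + area_density g p"
          by (simp add: area_density_def y_def[symmetric] power2_eq_square add_divide_distrib)
        ultimately have "\<bar>P p * Dx w p\<bar> \<le> area_density f p + area_density g p"
            "\<bar>Q p * Dy w p\<bar> \<le> area_density f p + area_density g p"
          by (simp_all only:)
        then show ?thesis
          unfolding mult_2 by (intro order_trans[OF abs_triangle_ineq] add_mono)
      qed
      have "norm (?T p) \<le> norm (2 * (?I f p + ?I g p))" for p
      proof (cases "p \<in> \<Omega>")
        case True
        then show ?thesis using bound[OF True] area_density_nonneg[of f p] area_density_nonneg[of g p] by simp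
      qed simp
      then show "AE p in lborel. norm (?T p) \<le> norm (2 * (?I f p + ?I g p))" by simp
    qed
    have W: "continuous_extension \<Omega> w (\<lambda>p. G p - F p)"
      using assms(9,11) by (auto simp: continuous_extension_def w_def intro!: continuous_intros)
    have T0: "integral\<^sup>L lborel ?T = 0"
      by (rule integral_flux_gradient_eq_0[OF assms(1,4) PQ div w W _ intT]) (use assms(12) in auto)
    \<comment> \<open>The excess of the density of \<open>g\<close> over its linearization at
      \<open>f\<close>. The linear term integrates to 0, so the integral of \<open>e\<close> is the
      difference of the areas.\<close>
    define e where "e = (\<lambda>p. area_density g p - area_density f p - (P p * Dx w p + Q p * Dy w p))"
    have e_nonneg: "0 \<le> e p" and e_0: "e p = 0 \<Longrightarrow> Dx w p = 0 \<and> Dy w p = 0" if p: "p \<in> \<Omega>" for p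
      using area_density_tangent[OF y_pos[OF p], of g f] unfolding e_def P_def Q_def Dw[OF p] by simp_all
    have ie: "indicator \<Omega> p * e p = ?I g p - ?I f p - ?T p" for p by (simp add: e_def algebra_simps)
    have int_e: "integrable lborel (\<lambda>p. indicator \<Omega> p * e p)"
      unfolding ie by (intro Bochner_Integration.integrable_diff If Ig intT)
    have "integral\<^sup>L lborel (\<lambda>p. indicator \<Omega> p * e p) = integral\<^sup>L lborel (?I g) - integral\<^sup>L lborel (?I f) - integral\<^sup>L lborel ?T"
      unfolding ie using If Ig intT by (simp add: Bochner_Integration.integral_diff)
    then have e_int: "integral\<^sup>L lborel (\<lambda>p. indicator \<Omega> p * e p) = integral\<^sup>L lborel (?I g) - integral\<^sup>L lborel (?I f)"
      using T0 by simp
    have nn: "0 \<le> indicator \<Omega> p * e p" for p using e_nonneg by (auto simp: indicator_def)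
    then have le: "integral\<^sup>L lborel (?I f) \<le> integral\<^sup>L lborel (?I g)"
      using e_int Bochner_Integration.integral_nonneg[of lborel "\<lambda>p. indicator \<Omega> p * e p"] by simp
    have "f p = g p" if eq: "area_H2R \<Omega> (graph_map f) = area_H2R \<Omega> (graph_map g)" and p: "p \<in> \<Omega>" for p
    proof -
      have "0 \<le> integral\<^sup>L lborel (?I h)" for h
        by (rule Bochner_Integration.integral_nonneg) (simp add: area_density_nonneg)
      then have "integral\<^sup>L lborel (?I f) = integral\<^sup>L lborel (?I g)"
        using eq unfolding I_eq[OF Cf(1) fin] I_eq[OF Cg True] by simp
      then have "AE p in lborel. indicator \<Omega> p * e p = 0"
        using e_int integral_nonneg_eq_0_iff_AE[OF int_e] nn by simp
      then have AE: "AE p in lborel. p \<in> \<Omega> \<longrightarrow> e p = 0" by eventually_elim auto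
      have "continuous_on \<Omega> e"
        unfolding e_def by (intro continuous_intros contT continuous_on_area_density sub Cf(1) Cg)
      then have grad0: "Dx w q = 0 \<and> Dy w q = 0" if "q \<in> \<Omega>" for q
        using e_0[OF that] continuous_AE_eq_0_open[OF assms(1) _ AE that] by blast
      have "(w has_derivative (\<lambda>x. 0)) (at q)" if "q \<in> \<Omega>" for q
        using C1_on_has_derivative[OF w assms(1), of "fst q" "snd q"] grad0[OF that] that
        by (simp add: case_prod_beta')
      then have const: "w q = w p" if "q \<in> \<Omega>" for q
        using has_derivative_zero_unique_connected[OF assms(1,2)] p that by blast
      \<comment> \<open>A bounded non-empty set has a frontier point. There the continuous extension
        of \<open>w\<close>, which is constant on \<open>\<Omega>\<close>, takes the value
        0.\<close>
      have "\<Omega> \<noteq> UNIV" using compact_imp_bounded[OF assms(4)] bounded_subset[OF _ closure_subset] not_bounded_UNIV by metis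
      then obtain q where q: "q \<in> frontier \<Omega>" using assms(3) frontier_eq_empty by blast
      have "G q - F q = w p"
      proof (rule continuous_constant_on_closure[where f="\<lambda>q. G q - F q" and S=\<Omega>])
        show "continuous_on (closure \<Omega>) (\<lambda>q. G q - F q)"
          using assms(9,11) by (auto simp: continuous_extension_def intro!: continuous_intros)
        show "G x - F x = w p" if "x \<in> \<Omega>" for x
          using assms(9,11) const[OF that] that by (simp add: continuous_extension_def w_def)
        show "q \<in> closure \<Omega>" using q by (simp add: frontier_def)
      qed
      then have "w p = 0" using q assms(12) by simp
      then show ?thesis by (simp add: w_def)
    qed
    then show ?thesis
      using same le unfolding I_eq[OF Cf(1) fin] I_eq[OF Cg True] by (auto intro: ennreal_leI)
  qed
qed

end
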